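(* Let $d\ge 1$ be an integer, $h>0$, $\sigma>0$, $1\le p\le +\infty$, $\lambda\in\{1,-1\}$, and let $V=\{V_n\}_{n\in h\mathbb{Z}^d}$ be a bounded real-valued sequence. Then the Cauchy problem for the discrete nonlinear Schr\"odinger equation $$ i u_n'(t)-\Delta_h u_n(t)+V_n u_n(t)+\lambda |u_n(t)|^{2\sigma}u_n(t)=0,\qquad u_n(0)=u_{n,0},\qquad n\in h\mathbb{Z}^d, $$ for complex-valued $u=\{u_n\}_{n\in h\mathbb{Z}^d}$, is locally well-posed in $l^p_h$.
   Context: For a sequence $u=\{u_n\}_{n\in h\mathbb{Z}^d}$, $\|u\|_{l^p_h}=\big(\sum_{n\in h\mathbb{Z}^d}|u_n|^p\big)^{1/p}$ for $1\le p<\infty$ and $\|u\|_{l^\infty_h}=\sup_n|u_n|$; $l^p_h$ is the Banach space of sequences with finite norm. The discrete Laplacian is $\Delta_h u_n=\sum_{j=1}^d h^{-2}(u_{n+he_j}+u_{n-he_j}-2u_n)$, with $(e_j)$ the canonical basis of $\mathbb{R}^d$. Local well-posedness in a space $X_0$ (here $X_0=l^p_h$) means: (a) unconditional uniqueness: for each initial datum in $X_0$ and each time interval $I\ni 0$, there is at most one solution in $C(I;X_0)$; (b) for every initial datum $u_0\in X_0$ there exists a strong solution (a function in $C(I;X_0)$ satisfying the equation and the initial condition) on a maximal time interval $I=(-T_{\min},T_{\max})$ with $T_{\min},T_{\max}\in(0,+\infty]$; (c) the solution depends continuously on the initial value (in the standard sense: if $u_0^k\to u_0$ in $X_0$, then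 on each compact subinterval $J$ of the maximal interval of $u$ the solutions $u^k$ exist for large $k$ and converge to $u$ in $C(J;X_0)$). *)

theory Defs
  imports "HOL-Analysis.Analysis"
begin

definition lattice :: "real \<Rightarrow> (real ^ 'd) set" where
  "lattice h = {n. \<forall>j. \<exists>k::int. n $ j = h * of_int k}"

text \<open>A sequence indexed by the lattice is a function on the whole of $R^d$ that
  vanishes off the lattice, so that equality of sequences is equality of functions.\<close>

definition lp_space :: "ereal \<Rightarrow> real \<Rightarrow> (real ^ 'd \<Rightarrow> complex) set" where
  "lp_space p h = {u. (\<forall>n. n \<notin> lattice h \<longrightarrow> u n = 0) \<and>
     (if p = \<infinity> then bdd_above ((\<lambda>n. cmod (u n)) ` lattice h)
      else (\<lambda>n. cmod (u n) powr real_of_ereal p) summable_on lattice h)}"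

definition lp_norm :: "ereal \<Rightarrow> real \<Rightarrow> (real ^ 'd \<Rightarrow> complex) \<Rightarrow> real" where
  "lp_norm p h u =
     (if p = \<infinity> then (SUP n\<in>lattice h. cmod (u n))
      else (\<Sum>\<^sub>\<infinity>n\<in>lattice h. cmod (u n) powr real_of_ereal p) powr (1 / real_of_ereal p))"

definition discrete_laplacian ::
    "real \<Rightarrow> (real ^ 'd \<Rightarrow> complex) \<Rightarrow> real ^ 'd \<Rightarrow> complex" where
  "discrete_laplacian h u n =
     (\<Sum>j\<in>UNIV. (u (n + h *\<^sub>R axis j 1) + u (n - h *\<^sub>R axis j 1) - 2 * u n) / of_real (h\<^sup>2))"

text \<open>The derivative is taken componentwise and within the interval, hence one-sided at
  endpoints belonging to it.\<close>

definition solves_dnls ::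
    "real \<Rightarrow> real \<Rightarrow> real \<Rightarrow> (real ^ 'd \<Rightarrow> real) \<Rightarrow> real set \<Rightarrow> (real \<Rightarrow> real ^ 'd \<Rightarrow> complex) \<Rightarrow> bool"
  where
  "solves_dnls h \<sigma> lam V I u \<longleftrightarrow>
     (\<forall>t\<in>I. \<forall>n\<in>lattice h. \<exists>u'. ((\<lambda>s. u s n) has_vector_derivative u') (at t within I) \<and>
        \<i> * u' - discrete_laplacian h (u t) n + of_real (V n) * u t n
          + of_real lam * of_real (cmod (u t n) powr (2 * \<sigma>)) * u t n = 0)"

text \<open>Local well-posedness of an abstract evolution equation in the normed space with carrier
  \<open>X\<close> and norm \<open>N\<close>; \<open>eqn I u\<close> says that \<open>u\<close> satisfies the equation on the interval \<open>I\<close>.\<close>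

definition continuous_into ::
    "'a::minus set \<Rightarrow> ('a \<Rightarrow> real) \<Rightarrow> real set \<Rightarrow> (real \<Rightarrow> 'a) \<Rightarrow> bool" where
  "continuous_into X N I u \<longleftrightarrow>
     (\<forall>t\<in>I. u t \<in> X) \<and> (\<forall>t\<in>I. ((\<lambda>s. N (u s - u t)) \<longlongrightarrow> 0) (at t within I))"

definition strong_solution ::
    "'a::minus set \<Rightarrow> ('a \<Rightarrow> real) \<Rightarrow> (real set \<Rightarrow> (real \<Rightarrow> 'a) \<Rightarrow> bool) \<Rightarrow>
     'a \<Rightarrow> real set \<Rightarrow> (real \<Rightarrow> 'a) \<Rightarrow> bool" where
  "strong_solution X N eqn u0 I u \<longleftrightarrow> continuous_into X N I u \<and> eqn I u \<and> u 0 = u0"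

definition maximal_solution ::
    "'a::minus set \<Rightarrow> ('a \<Rightarrow> real) \<Rightarrow> (real set \<Rightarrow> (real \<Rightarrow> 'a) \<Rightarrow> bool) \<Rightarrow>
     'a \<Rightarrow> real set \<Rightarrow> (real \<Rightarrow> 'a) \<Rightarrow> bool" where
  "maximal_solution X N eqn u0 I u \<longleftrightarrow>
     strong_solution X N eqn u0 I u \<and>
     (\<forall>J v. is_interval J \<and> I \<subseteq> J \<and> strong_solution X N eqn u0 J v \<and> (\<forall>t\<in>I. v t = u t)
        \<longrightarrow> J = I)"

definition unconditional_uniqueness ::
    "'a::minus set \<Rightarrow> ('a \<Rightarrow> real) \<Rightarrow> (real set \<Rightarrow> (real \<Rightarrow> 'a) \<Rightarrow> bool) \<Rightarrow> bool" where
  "unconditional_uniqueness X N eqn \<longleftrightarrow>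
     (\<forall>u0\<in>X. \<forall>I u v. is_interval I \<and> 0 \<in> I \<and>
        strong_solution X N eqn u0 I u \<and> strong_solution X N eqn u0 I v
        \<longrightarrow> (\<forall>t\<in>I. u t = v t))"

definition maximal_existence ::
    "'a::minus set \<Rightarrow> ('a \<Rightarrow> real) \<Rightarrow> (real set \<Rightarrow> (real \<Rightarrow> 'a) \<Rightarrow> bool) \<Rightarrow> bool" where
  "maximal_existence X N eqn \<longleftrightarrow>
     (\<forall>u0\<in>X. \<exists>Tmin Tmax u. 0 < Tmin \<and> 0 < Tmax \<and>
        maximal_solution X N eqn u0 (einterval (- Tmin) Tmax) u)"

definition continuous_dependence ::
    "'a::minus set \<Rightarrow> ('a \<Rightarrow> real) \<Rightarrow> (real set \<Rightarrow> (real \<Rightarrow> 'a) \<Rightarrow> bool) \<Rightarrow> bool" where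
  "continuous_dependence X N eqn \<longleftrightarrow>
     (\<forall>u0\<in>X. \<forall>Tmin Tmax u. \<forall>(u0s :: nat \<Rightarrow> 'a) Tmins Tmaxs us.
        0 < Tmin \<and> 0 < Tmax \<and>
        maximal_solution X N eqn u0 (einterval (- Tmin) Tmax) u \<and>
        (\<forall>k. u0s k \<in> X \<and> 0 < Tmins k \<and> 0 < Tmaxs k \<and>
           maximal_solution X N eqn (u0s k) (einterval (- Tmins k) (Tmaxs k)) (us k)) \<and>
        (\<lambda>k. N (u0s k - u0)) \<longlonglongrightarrow> 0
        \<longrightarrow> (\<forall>a b. {a..b} \<subseteq> einterval (- Tmin) Tmax \<longrightarrow>
              (\<forall>\<^sub>F k in sequentially. {a..b} \<subseteq> einterval (- Tmins k) (Tmaxs k)) \<and>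
              (\<forall>\<epsilon>>0. \<forall>\<^sub>F k in sequentially. \<forall>t\<in>{a..b}. N (us k t - u t) < \<epsilon>)))"

definition locally_well_posed ::
    "'a::minus set \<Rightarrow> ('a \<Rightarrow> real) \<Rightarrow> (real set \<Rightarrow> (real \<Rightarrow> 'a) \<Rightarrow> bool) \<Rightarrow> bool" where
  "locally_well_posed X N eqn \<longleftrightarrow>
     unconditional_uniqueness X N eqn \<and> maximal_existence X N eqn \<and>
     continuous_dependence X N eqn"

end

theory Submission
  imports Defs "HOL-Library.Function_Algebras"
begin

text \<open>The vector field of the equation is Lipschitz on bounded sets of \<open>l^p\<close>: the Laplacian and the
  potential are bounded operators, and since \<open>|u_n| \<le> \<parallel>u\<parallel>\<close>, replacing \<open>|u_n|\<close> by \<open>min |u_n| R\<close> in the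
  factor \<open>|u_n|^(2\<sigma>)\<close> gives a globally Lipschitz field that agrees with the original one on the ball
  of radius \<open>R\<close>. The truncated equations have global flows, by Picard iteration in a weighted sup
  norm, which depend Lipschitz-continuously on the initial value. On a compact interval a solution
  stays in some ball, hence is a trajectory of a truncated flow; uniqueness, extension beyond the
  endpoints and continuous dependence are all read off from these flows.\<close>

section \<open>Calculus for curves in a sequence space\<close>

text \<open>The equation is assumed coordinate by coordinate, while solutions are measured in a norm
  on a subset of a function space. Two properties of this norm bridge the gap: it dominates every
  coordinate, and its closed balls are closed under coordinatewise limits. The second one (Fatou's
  lemma when \<open>p\<close> is finite) yields completeness as well as the estimate of an increment
  by the norm of the derivative. The evolution theory is therefore carried out for an arbitrary norm
  of this kind, and the value of \<open>p\<close> enters only when these properties are verified.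

  Truncating each modulus, rather than cutting off by the norm of \<open>u\<close>, keeps the
  nonlinearity coordinatewise: its Lipschitz estimate is one inequality between complex numbers,
  transferred to the norm by solidity. That inequality is delicate for
  \<open>2 * \<sigma> < 1\<close>, where \<open>r powr (2 * \<sigma>)\<close> is not Lipschitz at
  \<open>0\<close>; the remaining factor \<open>u_n\<close> compensates for this.

  Truncation one unit above the bound of a given solution leaves room for continuing it beyond an
  endpoint and for perturbing its initial value.\<close>

lemma left_riemann_sums_tendsto:
  fixes u f :: "real \<Rightarrow> 'a :: real_normed_vector"
  assumes der: "\<And>s. s \<in> {0..1} \<Longrightarrow> (u has_vector_derivative f s) (at s within {0..1})"
    and cont: "continuous_on {0..1} f"
  shows "(\<lambda>k. \<Sum>i<Suc k. (1 / real (Suc k)) *\<^sub>R f (real i / real (Suc k))) \<longlonglongrightarrow> u 1 - u 0"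
proof (rule LIMSEQ_I)
  fix r :: real assume "r > 0"
  define e where "e = r / 2"
  have e: "e > 0" "e < r" using \<open>r > 0\<close> by (auto simp: e_def)
  have "uniformly_continuous_on {0..1} f"
    by (rule compact_uniformly_continuous[OF cont]) simp
  then obtain d where d: "d > 0" and
    uc: "\<And>x y. x \<in> {0..1} \<Longrightarrow> y \<in> {0..1} \<Longrightarrow> dist y x < d \<Longrightarrow> dist (f y) (f x) < e"
    unfolding uniformly_continuous_on_def using e(1) by blast
  obtain K :: nat where K: "inverse (real (Suc K)) < d" using reals_Archimedean[OF d] by auto
  show "\<exists>no. \<forall>k\<ge>no. norm ((\<Sum>i<Suc k. (1 / real (Suc k)) *\<^sub>R f (real i / real (Suc k))) - (u 1 - u 0)) < r"
  proof (intro exI allI impI)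
    fix k assume "k \<ge> K"
    define m where "m = Suc k"
    define t where "t i = real i / real m" for i
    have m: "m > 0" "1 / real m < d"
    proof -
      have "1 / real m \<le> inverse (real (Suc K))"
        unfolding m_def using \<open>k \<ge> K\<close> by (simp add: divide_simps)
      then show "1 / real m < d" using K by linarith
    qed (simp add: m_def)
    \<comment> \<open>On a cell, \<open>u\<close> differs from its linearization at the left
      endpoint by at most the cell length times the oscillation of \<open>f\<close>; the cell
      lengths add up to \<open>1\<close>.\<close>
    have step: "norm (u (t (Suc i)) - u (t i) - (1 / real m) *\<^sub>R f (t i)) \<le> 1 / real m * e"
      if "i < m" for i
    proof -
      have ti: "t i \<in> {0..1}" "t (Suc i) \<in> {0..1}" "t (Suc i) - t i = 1 / real m"
        using that m by (auto simp: t_def divide_simps)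
      have sub: "{t i..t (Suc i)} \<subseteq> {0..1}" using ti by auto
      have "norm (u (t (Suc i)) - u (t i) - (t (Suc i) - t i) *\<^sub>R f (t i))
          \<le> norm (t (Suc i) - t i) * e"
      proof (rule vector_differentiable_bound_linearization[where S = "{t i..t (Suc i)}"])
        show "(u has_vector_derivative f x) (at x within {t i..t (Suc i)})"
          if "x \<in> {t i..t (Suc i)}" for x
          using has_vector_derivative_within_subset[OF der sub] that sub by blast
        show "closed_segment (t i) (t (Suc i)) \<subseteq> {t i..t (Suc i)}"
          using m ti(3) by (simp add: closed_segment_eq_real_ivl) (smt (verit) divide_nonneg_nonneg of_nat_0_le_iff)
        show "t i \<in> {t i..t (Suc i)}" using ti by (simp add: divide_simps t_def)
        show "norm (f x - f (t i)) \<le> e" if "x \<in> {t i..t (Suc i)}" for x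
        proof -
          have "dist x (t i) < d" using that ti m by (auto simp: dist_real_def)
          then have "dist (f x) (f (t i)) < e" using uc that sub ti by blast
          then show ?thesis by (simp add: dist_norm)
        qed
      qed
      then show ?thesis unfolding ti(3) by simp
    qed
    have "u 1 - u 0 = (\<Sum>i<m. u (t (Suc i)) - u (t i))"
      using sum_lessThan_telescope[of "\<lambda>i. u (t i)" m] m by (simp add: t_def)
    then have "norm ((\<Sum>i<m. (1 / real m) *\<^sub>R f (t i)) - (u 1 - u 0))
        = norm (\<Sum>i<m. u (t (Suc i)) - u (t i) - (1 / real m) *\<^sub>R f (t i))"
      by (simp only: sum_subtractf norm_minus_commute)
    also have "\<dots> \<le> (\<Sum>i<m. 1 / real m * e)"
      by (rule sum_norm_le) (use step in auto)
    also have "\<dots> = e" using m by simp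
    finally show "norm ((\<Sum>i<Suc k. (1 / real (Suc k)) *\<^sub>R f (real i / real (Suc k))) - (u 1 - u 0)) < r"
      using e(2) by (simp add: t_def m_def)
  qed
qed

lemma continuous_into_mem: "continuous_into X N S u \<Longrightarrow> t \<in> S \<Longrightarrow> u t \<in> X"
  unfolding continuous_into_def by blast

lemma continuous_into_tendsto:
  "continuous_into X N S u \<Longrightarrow> t \<in> S \<Longrightarrow> ((\<lambda>s. N (u s - u t)) \<longlongrightarrow> 0) (at t within S)"
  unfolding continuous_into_def by blast

lemma continuous_into_subset:
  "continuous_into X N S u \<Longrightarrow> T \<subseteq> S \<Longrightarrow> continuous_into X N T u"
  unfolding continuous_into_def by (meson subsetD tendsto_within_subset)

text \<open>\<open>N_point\<close> is the embedding into bounded sequences; it also makes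
  \<open>N\<close> nonnegative and definite on \<open>X\<close>. The conclusion of
  \<open>fatou\<close> includes membership, which is what turns coordinatewise limits into elements
  of \<open>X\<close>. The inequality \<open>N_scale\<close> already forces
  \<open>N (- x) = N x\<close>.\<close>

locale fatou_norm =
  fixes X :: "('i \<Rightarrow> complex) set" and N :: "('i \<Rightarrow> complex) \<Rightarrow> real"
  assumes zero_mem: "0 \<in> X"
    and add_mem: "x \<in> X \<Longrightarrow> y \<in> X \<Longrightarrow> x + y \<in> X"
    and N_add: "x \<in> X \<Longrightarrow> y \<in> X \<Longrightarrow> N (x + y) \<le> N x + N y"
    and scale_mem: "x \<in> X \<Longrightarrow> (\<lambda>n. c * x n) \<in> X"
    and N_scale: "x \<in> X \<Longrightarrow> N (\<lambda>n. c * x n) \<le> cmod c * N x"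
    and N_point: "x \<in> X \<Longrightarrow> cmod (x n) \<le> N x"
    and fatou: "\<And>(xs :: nat \<Rightarrow> 'i \<Rightarrow> complex) C y.
      (\<And>k. xs k \<in> X) \<Longrightarrow> (\<And>k. N (xs k) \<le> C) \<Longrightarrow> (\<And>n. (\<lambda>k. xs k n) \<longlonglongrightarrow> y n) \<Longrightarrow> y \<in> X \<and> N y \<le> C"
begin

section \<open>Elementary properties of the norm and completeness\<close>

lemma N_nonneg: "x \<in> X \<Longrightarrow> 0 \<le> N x"
  using N_point[of x undefined] norm_ge_zero order_trans by blast

lemma N_zero: "N 0 = 0"
proof -
  have "(\<lambda>n. 0 * (0 :: 'i \<Rightarrow> complex) n) = 0" by (auto simp: fun_eq_iff)
  then have "N 0 \<le> 0" using N_scale[OF zero_mem, of 0] by simp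
  then show ?thesis using N_nonneg[OF zero_mem] by simp
qed

lemma N_eq_zero:
  assumes "x \<in> X" "N x \<le> 0" shows "x = 0"
proof
  fix n
  have "norm (x n) \<le> 0" using N_point[OF assms(1), of n] assms(2) by linarith
  then show "x n = 0 n" by simp
qed

lemma uminus_mem: "x \<in> X \<Longrightarrow> - x \<in> X"
proof -
  have "(\<lambda>n. (-1) * x n) = - x" for x :: "'i \<Rightarrow> complex" by (auto simp: fun_eq_iff)
  then show "x \<in> X \<Longrightarrow> - x \<in> X" using scale_mem[of x "-1"] by simp
qed

lemma N_uminus: "x \<in> X \<Longrightarrow> N (- x) = N x"
proof -
  have eq: "(\<lambda>n. (-1) * x n) = - x" for x :: "'i \<Rightarrow> complex" by (auto simp: fun_eq_iff)
  have le: "x \<in> X \<Longrightarrow> N (- x) \<le> N x" for x using N_scale[of x "-1"] unfolding eq by simp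
  show "x \<in> X \<Longrightarrow> N (- x) = N x" using le[of x] le[of "- x"] uminus_mem[of x] by simp
qed

lemma diff_mem: "x \<in> X \<Longrightarrow> y \<in> X \<Longrightarrow> x - y \<in> X"
  using add_mem[of x "- y"] uminus_mem[of y] by simp

lemma N_diff: "x \<in> X \<Longrightarrow> y \<in> X \<Longrightarrow> N (x - y) \<le> N x + N y"
  using N_add[of x "- y"] uminus_mem[of y] N_uminus[of y] by simp

lemma N_minus_commute: "x \<in> X \<Longrightarrow> y \<in> X \<Longrightarrow> N (x - y) = N (y - x)"
  using N_uminus[of "x - y"] diff_mem[of x y] by simp

lemma N_triangle: "x \<in> X \<Longrightarrow> y \<in> X \<Longrightarrow> z \<in> X \<Longrightarrow> N (x - z) \<le> N (x - y) + N (y - z)"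
  using N_add[of "x - y" "y - z"] diff_mem[of x y] diff_mem[of y z] by simp

lemma N_triangle_le: "x \<in> X \<Longrightarrow> y \<in> X \<Longrightarrow> N x \<le> N y + N (x - y)"
  using N_add[of y "x - y"] diff_mem[of x y] by simp

lemma abs_N_diff_le:
  assumes "x \<in> X" "y \<in> X" shows "\<bar>N x - N y\<bar> \<le> N (x - y)"
  using N_triangle_le[OF assms] N_triangle_le[OF assms(2,1)] N_minus_commute[OF assms] by linarith

lemma sum_mem_N_le:
  "finite A \<Longrightarrow> (\<And>i. i \<in> A \<Longrightarrow> x i \<in> X) \<Longrightarrow> (\<lambda>n. \<Sum>i\<in>A. x i n) \<in> X \<and> N (\<lambda>n. \<Sum>i\<in>A. x i n) \<le> (\<Sum>i\<in>A. N (x i))"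
proof (induction A rule: finite_induct)
  case empty
  have "(\<lambda>n. \<Sum>i\<in>{}. x i n) = 0" by (auto simp: fun_eq_iff)
  then show ?case using zero_mem N_zero by simp
next
  case (insert a A)
  have "(\<lambda>n. \<Sum>i\<in>insert a A. x i n) = x a + (\<lambda>n. \<Sum>i\<in>A. x i n)"
    using insert.hyps by (auto simp: fun_eq_iff)
  then show ?case using insert add_mem N_add by (smt (verit) insertCI sum.insert)
qed

text \<open>Completeness in the form that Picard iteration asks for. \<open>N_point\<close> makes
  every coordinate converge; \<open>fatou\<close>, applied to \<open>x k - x (k + j)\<close> as
  \<open>j\<close> grows, then gives membership and the tail bound at once.\<close>

lemma geometric_limit:
  assumes mem: "\<And>k :: nat. x k \<in> X" and step: "\<And>k. N (x (Suc k) - x k) \<le> c * (1/2) ^ k"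
  shows "\<exists>y\<in>X. \<forall>k. N (x k - y) \<le> 2 * c * (1/2) ^ k"
proof -
  have c: "c \<ge> 0" using step[of 0] N_nonneg[OF diff_mem[OF mem[of 1] mem[of 0]]] by simp
  \<comment> \<open>Keeping the subtracted term lets the induction on \<open>j\<close> close, since
    the steps telescope.\<close>
  have dist: "N (x k - x (k + j)) \<le> 2 * c * (1/2) ^ k - 2 * c * (1/2) ^ (k + j)" for k j
  proof (induction j)
    case 0 then show ?case by (simp add: N_zero[unfolded zero_fun_def])
  next
    case (Suc j)
    have "N (x k - x (k + Suc j)) \<le> N (x k - x (k + j)) + N (x (k + j) - x (k + Suc j))"
      using N_triangle mem by blast
    also have "N (x (k + j) - x (k + Suc j)) \<le> c * (1/2) ^ (k + j)"
      using step[of "k + j"] N_minus_commute[OF mem mem] by simp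
    also have "c * (1/2) ^ (k + j) = 2 * c * (1/2) ^ (k + j) - 2 * c * (1/2) ^ (k + Suc j)" by simp
    finally show ?case using Suc by linarith
  qed
  have conv: "convergent (\<lambda>k. x k n)" for n
  proof -
    have "summable (\<lambda>k. x (Suc k) n - x k n)"
    proof (rule summable_comparison_test')
      show "summable (\<lambda>k. c * (1/2 :: real) ^ k)" by (intro summable_mult summable_geometric) simp
      show "norm (x (Suc k) n - x k n) \<le> c * (1/2) ^ k" if "k \<ge> 0" for k
        using N_point[OF diff_mem[OF mem mem], of "Suc k" k n] step[of k] by simp
    qed
    then have "convergent (\<lambda>k. \<Sum>i<k. x (Suc i) n - x i n)"
      by (simp add: summable_iff_convergent)
    then have "convergent (\<lambda>k. x k n - x 0 n)" by (simp add: sum_lessThan_telescope[of "\<lambda>i. x i n"])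
    then obtain l where "(\<lambda>k. x k n - x 0 n) \<longlonglongrightarrow> l" by (auto simp: convergent_def)
    then have "(\<lambda>k. (x k n - x 0 n) + x 0 n) \<longlonglongrightarrow> l + x 0 n" by (intro tendsto_intros)
    then show ?thesis by (auto simp: convergent_def)
  qed
  define y where "y n = lim (\<lambda>k. x k n)" for n
  have y: "(\<lambda>k. x k n) \<longlonglongrightarrow> y n" for n
    using conv[of n] by (simp add: y_def convergent_LIMSEQ_iff)
  have lim: "x k - y \<in> X \<and> N (x k - y) \<le> 2 * c * (1/2) ^ k" for k
  proof (rule fatou[where xs = "\<lambda>j. x k - x (k + j)"])
    show "x k - x (k + j) \<in> X" for j by (intro diff_mem mem)
    show "N (x k - x (k + j)) \<le> 2 * c * (1/2) ^ k" for j
      using dist[of k j] c by (smt (verit) mult_nonneg_nonneg zero_le_power divide_nonneg_nonneg)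
    show "(\<lambda>j. (x k - x (k + j)) n) \<longlonglongrightarrow> (x k - y) n" for n
      unfolding minus_apply using LIMSEQ_ignore_initial_segment[OF y[of n], of k]
      by (intro tendsto_intros) (simp add: add.commute)
  qed
  \<comment> \<open>\<open>fatou\<close> was applied to differences, so \<open>y\<close> itself is
    recovered from one of them.\<close>
  have "x 0 - (x 0 - y) \<in> X" using lim mem diff_mem by blast
  then have "y \<in> X" by simp
  then show ?thesis using lim by blast
qed

section \<open>Curves that are continuous in norm\<close>

lemma continuous_into_const: "c \<in> X \<Longrightarrow> continuous_into X N S (\<lambda>_. c)"
  unfolding continuous_into_def diff_self N_zero by simp

lemma continuous_into_compare:
  assumes u: "continuous_into X N S u" and v: "\<And>s. s \<in> S \<Longrightarrow> v s \<in> X"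
    and le: "\<And>s t. s \<in> S \<Longrightarrow> t \<in> S \<Longrightarrow> N (v s - v t) \<le> L * N (u s - u t)"
  shows "continuous_into X N S v"
  unfolding continuous_into_def
proof (intro conjI ballI)
  fix t assume t: "t \<in> S"
  show "v t \<in> X" using v t .
  have ev: "\<forall>\<^sub>F s in at t within S. s \<in> S" by (auto simp: eventually_at_filter)
  show "((\<lambda>s. N (v s - v t)) \<longlongrightarrow> 0) (at t within S)"
  proof (rule tendsto_sandwich[OF _ _ tendsto_const])
    show "\<forall>\<^sub>F s in at t within S. 0 \<le> N (v s - v t)"
      using ev by eventually_elim (intro N_nonneg diff_mem v t)
    show "\<forall>\<^sub>F s in at t within S. N (v s - v t) \<le> L * N (u s - u t)"
      using ev by eventually_elim (use le t in blast)
    show "((\<lambda>s. L * N (u s - u t)) \<longlongrightarrow> 0) (at t within S)"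
      using tendsto_mult_right_zero[OF continuous_into_tendsto[OF u t]] .
  qed
qed

lemma continuous_into_diff:
  assumes u: "continuous_into X N S u" and v: "continuous_into X N S v"
  shows "continuous_into X N S (\<lambda>s. u s - v s)"
  unfolding continuous_into_def
proof (intro conjI ballI)
  note um = continuous_into_mem[OF u] and vm = continuous_into_mem[OF v]
  fix t assume t: "t \<in> S"
  show "u t - v t \<in> X" using um vm t diff_mem by blast
  have ev: "\<forall>\<^sub>F s in at t within S. s \<in> S" by (auto simp: eventually_at_filter)
  show "((\<lambda>s. N ((u s - v s) - (u t - v t))) \<longlongrightarrow> 0) (at t within S)"
  proof (rule tendsto_sandwich[OF _ _ tendsto_const])
    show "\<forall>\<^sub>F s in at t within S. 0 \<le> N ((u s - v s) - (u t - v t))"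
      using ev by eventually_elim (intro N_nonneg diff_mem um vm t)
    show "\<forall>\<^sub>F s in at t within S. N ((u s - v s) - (u t - v t)) \<le> N (u s - u t) + N (v s - v t)"
      using ev
    proof eventually_elim
      case (elim s)
      have "(u s - v s) - (u t - v t) = (u s - u t) - (v s - v t)" by simp
      moreover have "N ((u s - u t) - (v s - v t)) \<le> N (u s - u t) + N (v s - v t)"
        by (intro N_diff diff_mem um vm elim t)
      ultimately show ?case by (simp only:)
    qed
    show "((\<lambda>s. N (u s - u t) + N (v s - v t)) \<longlongrightarrow> 0) (at t within S)"
      using tendsto_add[OF continuous_into_tendsto[OF u t] continuous_into_tendsto[OF v t]] by simp
  qed
qed

lemma continuous_into_component:
  assumes u: "continuous_into X N S u"
  shows "continuous_on S (\<lambda>s. u s n)"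
  unfolding continuous_on_def
proof
  fix t assume t: "t \<in> S"
  have ev: "\<forall>\<^sub>F s in at t within S. s \<in> S" by (auto simp: eventually_at_filter)
  have "((\<lambda>s. u s n - u t n) \<longlongrightarrow> 0) (at t within S)"
  proof (rule Lim_null_comparison)
    show "\<forall>\<^sub>F s in at t within S. norm (u s n - u t n) \<le> N (u s - u t)"
      using ev
      by eventually_elim
        (use N_point[OF diff_mem[OF continuous_into_mem[OF u] continuous_into_mem[OF u]]] t in fastforce)
  qed (rule continuous_into_tendsto[OF u t])
  then show "((\<lambda>s. u s n) \<longlongrightarrow> u t n) (at t within S)" by (simp add: LIM_zero_iff)
qed

lemma continuous_on_N:
  assumes u: "continuous_into X N S u"
  shows "continuous_on S (\<lambda>s. N (u s))"
  unfolding continuous_on_def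
proof
  fix t assume t: "t \<in> S"
  have ev: "\<forall>\<^sub>F s in at t within S. s \<in> S" by (auto simp: eventually_at_filter)
  have "((\<lambda>s. N (u s) - N (u t)) \<longlongrightarrow> 0) (at t within S)"
  proof (rule Lim_null_comparison)
    show "\<forall>\<^sub>F s in at t within S. norm (N (u s) - N (u t)) \<le> N (u s - u t)"
      using ev
      by eventually_elim
        (use abs_N_diff_le[OF continuous_into_mem[OF u] continuous_into_mem[OF u]] t in fastforce)
  qed (rule continuous_into_tendsto[OF u t])
  then show "((\<lambda>s. N (u s)) \<longlongrightarrow> N (u t)) (at t within S)" by (simp add: LIM_zero_iff)
qed

lemma continuous_into_bounded:
  assumes "continuous_into X N S u" "compact S"
  obtains B where "B > 0" "\<And>s. s \<in> S \<Longrightarrow> N (u s) \<le> B"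
proof -
  have "bounded ((\<lambda>s. N (u s)) ` S)"
    using compact_continuous_image[OF continuous_on_N[OF assms(1)] assms(2)] compact_imp_bounded by blast
  then obtain B where B: "B > 0" "\<And>s. s \<in> S \<Longrightarrow> norm (N (u s)) \<le> B"
    by (auto simp: bounded_pos)
  show ?thesis by (rule that[OF B(1)]) (use B(2) in \<open>fastforce simp: abs_le_iff\<close>)
qed

text \<open>\<open>N\<close> is lower semicontinuous under pointwise convergence, so it can be estimated on the
  left Riemann sums of the componentwise integral; no vector-valued integral is needed.\<close>

lemma increment_bound_unit:
  assumes der: "\<And>s n. s \<in> {0..1} \<Longrightarrow> ((\<lambda>r. u r n) has_vector_derivative f s n) (at s within {0..1})"
    and cont: "\<And>n. continuous_on {0..1} (\<lambda>s. f s n)"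
    and mem: "\<And>s. s \<in> {0..1} \<Longrightarrow> f s \<in> X"
    and le: "\<And>x y. 0 \<le> x \<Longrightarrow> x \<le> y \<Longrightarrow> y \<le> 1 \<Longrightarrow> (y - x) * N (f x) \<le> \<phi> y - \<phi> x"
  shows "u 1 - u 0 \<in> X \<and> N (u 1 - u 0) \<le> \<phi> 1 - \<phi> 0"
proof (rule fatou[where xs = "\<lambda>k n. \<Sum>i<Suc k. (1 / complex_of_real (real (Suc k))) * f (real i / real (Suc k)) n"])
  fix k
  define m where "m = Suc k"
  have m: "m > 0" by (simp add: m_def)
  define x where "x i = (\<lambda>n. (1 / complex_of_real (real m)) * f (real i / real m) n)" for i
  have unit: "real i / real m \<in> {0..1}" if "i \<in> {..<m}" for i
    using that m by (auto simp: divide_simps)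
  have sm: "(\<lambda>n. \<Sum>i<m. x i n) \<in> X \<and> N (\<lambda>n. \<Sum>i<m. x i n) \<le> (\<Sum>i<m. N (x i))"
    by (rule sum_mem_N_le) (unfold x_def, simp, rule scale_mem[OF mem[OF unit]])
  have "N (x i) \<le> \<phi> (real (Suc i) / real m) - \<phi> (real i / real m)" if "i \<in> {..<m}" for i
  proof -
    have "N (x i) \<le> cmod (1 / complex_of_real (real m)) * N (f (real i / real m))"
      unfolding x_def by (rule N_scale[OF mem[OF unit[OF that]]])
    also have "\<dots> = (real (Suc i) / real m - real i / real m) * N (f (real i / real m))"
      by (simp add: norm_divide diff_divide_distrib[symmetric])
    also have "\<dots> \<le> \<phi> (real (Suc i) / real m) - \<phi> (real i / real m)"
      by (rule le) (use that m in \<open>auto simp: divide_simps\<close>)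
    finally show ?thesis .
  qed
  \<comment> \<open>The hypothesis on \<open>\<phi>\<close> bounds a left rectangle by the increment
    of \<open>\<phi>\<close> over its cell, so the bounds telescope.\<close>
  then have "(\<Sum>i<m. N (x i)) \<le> (\<Sum>i<m. \<phi> (real (Suc i) / real m) - \<phi> (real i / real m))"
    by (rule sum_mono)
  also have "\<dots> = \<phi> 1 - \<phi> 0"
    using sum_lessThan_telescope[of "\<lambda>i. \<phi> (real i / real m)" m] m by simp
  finally show "N (\<lambda>n. \<Sum>i<Suc k. (1 / complex_of_real (real (Suc k))) * f (real i / real (Suc k)) n) \<le> \<phi> 1 - \<phi> 0"
    using sm unfolding x_def m_def by linarith
  show "(\<lambda>n. \<Sum>i<Suc k. (1 / complex_of_real (real (Suc k))) * f (real i / real (Suc k)) n) \<in> X"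
    using sm unfolding x_def m_def by blast
next
  fix n
  have *: "(1 / complex_of_real a) * z = (1 / a) *\<^sub>R z" for a z
    by (simp add: scaleR_conv_of_real)
  show "(\<lambda>k. \<Sum>i<Suc k. (1 / complex_of_real (real (Suc k))) * f (real i / real (Suc k)) n) \<longlonglongrightarrow> (u 1 - u 0) n"
    unfolding minus_apply *
    by (rule left_riemann_sums_tendsto) (use der cont in auto)
qed

text \<open>Affine reparametrization of the unit interval. Closed segments allow
  \<open>b < a\<close>, so forward and backward time are treated together; \<open>\<phi>\<close>
  remains a function of the parameter in \<open>{0..1}\<close>.\<close>

lemma increment_bound:
  assumes der: "\<And>s n. s \<in> closed_segment a b \<Longrightarrow> ((\<lambda>r. u r n) has_vector_derivative f s n) (at s within closed_segment a b)"
    and cont: "\<And>n. continuous_on (closed_segment a b) (\<lambda>s. f s n)"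
    and mem: "\<And>s. s \<in> closed_segment a b \<Longrightarrow> f s \<in> X"
    and le: "\<And>x y. 0 \<le> x \<Longrightarrow> x \<le> y \<Longrightarrow> y \<le> 1 \<Longrightarrow>
      (y - x) * (\<bar>b - a\<bar> * N (f (a + x * (b - a)))) \<le> \<phi> y - \<phi> x"
  shows "u b - u a \<in> X \<and> N (u b - u a) \<le> \<phi> 1 - \<phi> 0"
proof -
  define g where "g r = a + r * (b - a)" for r
  have img: "g ` {0..1} = closed_segment a b"
    by (auto simp: g_def closed_segment_real_eq mult.commute)
  have gder: "(g has_vector_derivative (b - a)) (at s within {0..1})" for s
    unfolding g_def by (auto intro!: derivative_eq_intros)
  have "u (g 1) - u (g 0) \<in> X \<and> N (u (g 1) - u (g 0)) \<le> \<phi> 1 - \<phi> 0"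
  proof (rule increment_bound_unit[where u = "\<lambda>r. u (g r)" and f = "\<lambda>r n. of_real (b - a) * f (g r) n"])
    show "((\<lambda>r. u (g r) n) has_vector_derivative of_real (b - a) * f (g s) n) (at s within {0..1})"
      if "s \<in> {0..1}" for s n
    proof -
      have "((\<lambda>r. u r n) has_vector_derivative f (g s) n) (at (g s) within g ` {0..1})"
        unfolding img by (rule der) (use img that in blast)
      from vector_diff_chain_within[OF gder this] show ?thesis
        by (simp add: o_def scaleR_conv_of_real)
    qed
    show "continuous_on {0..1} (\<lambda>s. of_real (b - a) * f (g s) n)" for n
    proof (intro continuous_intros)
      have "continuous_on {0..1} g" unfolding g_def by (intro continuous_intros)
      then show "continuous_on {0..1} (\<lambda>s. f (g s) n)"
        using continuous_on_compose2[OF cont] img by blast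
    qed
    show "(\<lambda>n. of_real (b - a) * f (g s) n) \<in> X" if "s \<in> {0..1}" for s
      using scale_mem mem img that by blast
    show "(y - x) * N (\<lambda>n. of_real (b - a) * f (g x) n) \<le> \<phi> y - \<phi> x"
      if xy: "0 \<le> x" "x \<le> y" "y \<le> 1" for x y
    proof -
      have "f (g x) \<in> X" using mem img xy by force
      then have "N (\<lambda>n. of_real (b - a) * f (g x) n) \<le> \<bar>b - a\<bar> * N (f (g x))"
        using N_scale[of "f (g x)" "of_real (b - a)"] by (simp only: norm_of_real)
      then have "(y - x) * N (\<lambda>n. of_real (b - a) * f (g x) n) \<le> (y - x) * (\<bar>b - a\<bar> * N (f (g x)))"
        using xy by (intro mult_left_mono) auto
      then show ?thesis using le[OF xy] unfolding g_def by linarith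
    qed
  qed
  then show ?thesis by (simp add: g_def)
qed

lemma increment_bound_const:
  assumes der: "\<And>s n. s \<in> closed_segment a b \<Longrightarrow> ((\<lambda>r. u r n) has_vector_derivative f s n) (at s within closed_segment a b)"
    and f: "continuous_into X N (closed_segment a b) f"
    and le: "\<And>s. s \<in> closed_segment a b \<Longrightarrow> N (f s) \<le> B"
  shows "u b - u a \<in> X \<and> N (u b - u a) \<le> B * \<bar>b - a\<bar>"
proof -
  have "u b - u a \<in> X \<and> N (u b - u a) \<le> B * \<bar>b - a\<bar> * 1 - B * \<bar>b - a\<bar> * 0"
  proof (rule increment_bound[OF der continuous_into_component[OF f] continuous_into_mem[OF f]])
    fix x y :: real assume xy: "0 \<le> x" "x \<le> y" "y \<le> 1"
    have "a + x * (b - a) \<in> closed_segment a b"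
      using xy by (auto simp: closed_segment_real_eq mult.commute)
    then have "N (f (a + x * (b - a))) \<le> B" by (rule le)
    then have "(y - x) * (\<bar>b - a\<bar> * N (f (a + x * (b - a)))) \<le> (y - x) * (\<bar>b - a\<bar> * B)"
      using xy by (intro mult_left_mono) auto
    then show "(y - x) * (\<bar>b - a\<bar> * N (f (a + x * (b - a)))) \<le> B * \<bar>b - a\<bar> * y - B * \<bar>b - a\<bar> * x"
      by (simp add: algebra_simps)
  qed
  then show ?thesis by simp
qed

text \<open>The bound is the integral of \<open>L * (C * exp (2 * L * s))\<close> over
  \<open>{0..\<bar>t\<bar>}\<close>. Integrating a weight of rate \<open>2 * L\<close> divides by
  \<open>2 * L\<close>, and this is the origin of the contraction factor \<open>1/2\<close>.\<close>

lemma increment_bound_exp: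
  assumes der: "\<And>s n. s \<in> closed_segment 0 t \<Longrightarrow> ((\<lambda>r. u r n) has_vector_derivative f s n) (at s within closed_segment 0 t)"
    and f: "continuous_into X N (closed_segment 0 t) f"
    and le: "\<And>s. s \<in> closed_segment 0 t \<Longrightarrow> N (f s) \<le> L * (C * exp (2 * L * \<bar>s\<bar>))"
    and C: "C \<ge> 0"
  shows "u t - u 0 \<in> X \<and> N (u t - u 0) \<le> C / 2 * (exp (2 * L * \<bar>t\<bar>) - 1)"
proof -
  define \<phi> where "\<phi> r = C / 2 * exp (2 * L * \<bar>t\<bar> * r)" for r
  have "u t - u 0 \<in> X \<and> N (u t - u 0) \<le> \<phi> 1 - \<phi> 0"
  proof (rule increment_bound[OF der continuous_into_component[OF f] continuous_into_mem[OF f]])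
    fix x y :: real assume xy: "0 \<le> x" "x \<le> y" "y \<le> 1"
    have "x * t \<in> closed_segment 0 t"
      using xy by (auto simp: closed_segment_real_eq mult.commute)
    define z where "z = 2 * L * \<bar>t\<bar> * x"
    have "N (f (x * t)) \<le> L * (C * exp z)"
      using le[OF \<open>x * t \<in> _\<close>] xy by (simp add: z_def abs_mult mult_ac)
    then have "(y - x) * (\<bar>t\<bar> * N (f (x * t))) \<le> (y - x) * (\<bar>t\<bar> * (L * (C * exp z)))"
      using xy by (intro mult_left_mono) auto
    also have "\<dots> = C / 2 * exp z * (2 * L * \<bar>t\<bar> * (y - x))" by (simp add: field_simps)
    \<comment> \<open>The exponential lies above its tangent, so a left rectangle is below the
      increment.\<close>
    also have "\<dots> \<le> C / 2 * exp z * (exp (2 * L * \<bar>t\<bar> * (y - x)) - 1)"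
      using C exp_ge_add_one_self[of "2 * L * \<bar>t\<bar> * (y - x)"]
      by (intro mult_left_mono) (linarith, simp)
    also have "\<dots> = C / 2 * exp (z + 2 * L * \<bar>t\<bar> * (y - x)) - C / 2 * exp z"
      by (simp only: exp_add) (simp add: algebra_simps)
    also have "\<dots> = \<phi> y - \<phi> x" by (simp add: z_def \<phi>_def algebra_simps)
    finally show "(y - x) * (\<bar>t - 0\<bar> * N (f (0 + x * (t - 0)))) \<le> \<phi> y - \<phi> x" by simp
  qed
  then show ?thesis by (simp add: \<phi>_def algebra_simps)
qed

end

section \<open>Globally Lipschitz vector fields\<close>

context fatou_norm
begin

text \<open>Coordinatewise differentiability becomes continuity in norm: the increment bound makes
  \<open>v\<close> Lipschitz around each time, with the constant \<open>M\<close> taken from the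
  compact unit ball about it.\<close>

lemma continuous_into_primitive:
  assumes f: "continuous_into X N UNIV f"
    and der: "\<And>t n. ((\<lambda>s. v s n) has_vector_derivative f t n) (at t)"
    and v0: "v 0 \<in> X"
  shows "continuous_into X N UNIV v"
  unfolding continuous_into_def
proof (intro conjI ballI)
  fix t :: real
  have inc: "v b - v a \<in> X \<and> N (v b - v a) \<le> B * \<bar>b - a\<bar>"
    if "\<And>s. s \<in> closed_segment a b \<Longrightarrow> N (f s) \<le> B" for a b B
    by (rule increment_bound_const[OF has_vector_derivative_at_within[OF der]
          continuous_into_subset[OF f subset_UNIV] that])
  obtain B where "\<And>s. s \<in> closed_segment 0 t \<Longrightarrow> N (f s) \<le> B"
    by (rule continuous_into_bounded[OF continuous_into_subset[OF f subset_UNIV], of "closed_segment 0 t"]) auto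
  then have "v t - v 0 \<in> X" using inc by blast
  then have "(v t - v 0) + v 0 \<in> X" using v0 by (rule add_mem)
  then show "v t \<in> X" by simp
  obtain M where M: "\<And>s. s \<in> cball t 1 \<Longrightarrow> N (f s) \<le> M"
    by (rule continuous_into_bounded[OF continuous_into_subset[OF f subset_UNIV], of "cball t 1"]) auto
  have bd: "0 \<le> N (v s - v t) \<and> N (v s - v t) \<le> M * \<bar>s - t\<bar>" if "dist s t < 1" for s
  proof -
    have "closed_segment t s \<subseteq> cball t 1"
      using that by (intro closed_segment_subset) (auto simp: dist_commute)
    then show ?thesis using inc[of t s M] M N_nonneg by blast
  qed
  have ev: "\<forall>\<^sub>F s in at t. dist s t < 1"
    using eventually_at_ball[of 1 t UNIV] by (simp add: dist_commute)
  show "((\<lambda>s. N (v s - v t)) \<longlongrightarrow> 0) (at t)"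
  proof (rule tendsto_sandwich[OF _ _ tendsto_const])
    show "\<forall>\<^sub>F s in at t. 0 \<le> N (v s - v t)" using ev by eventually_elim (use bd in blast)
    show "\<forall>\<^sub>F s in at t. N (v s - v t) \<le> M * \<bar>s - t\<bar>" using ev by eventually_elim (use bd in blast)
    have "((\<lambda>s. M * \<bar>s - t\<bar>) \<longlongrightarrow> M * \<bar>t - t\<bar>) (at t)" by (intro tendsto_intros)
    then show "((\<lambda>s. M * \<bar>s - t\<bar>) \<longlongrightarrow> 0) (at t)" by simp
  qed
qed

text \<open>The convergence is uniform only relative to the weight \<open>g\<close>. Continuity of
  \<open>g\<close> at \<open>t\<close> lets a single index \<open>k\<close> serve all nearby times,
  after which three errors of size \<open>e / 3\<close> add up.\<close>

lemma continuous_into_locally_uniform_limit: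
  assumes u: "\<And>k :: nat. continuous_into X N UNIV (u k)" and w: "\<And>t. w t \<in> X"
    and le: "\<And>k t. N (u k t - w t) \<le> b k * g t"
    and b: "b \<longlonglongrightarrow> 0" and g: "continuous_on UNIV g"
  shows "continuous_into X N UNIV w"
  unfolding continuous_into_def
proof (intro conjI ballI)
  fix t :: real
  note um = continuous_into_mem[OF u UNIV_I]
  show "w t \<in> X" by (rule w)
  show "((\<lambda>s. N (w s - w t)) \<longlongrightarrow> 0) (at t)"
  proof (rule tendstoI)
    fix e :: real assume e: "e > 0"
    have "(\<lambda>k. b k * g t) \<longlonglongrightarrow> 0 * g t" by (intro tendsto_intros b)
    then have "\<forall>\<^sub>F k in sequentially. b k * g t < e / 3"
      using e by (intro order_tendstoD) auto
    then obtain k where k: "b k * g t < e / 3" by (auto simp: eventually_sequentially)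
    have "((\<lambda>s. b k * g s) \<longlongrightarrow> b k * g t) (at t)"
      using g by (intro tendsto_intros) (auto simp: continuous_on_def)
    then have "\<forall>\<^sub>F s in at t. b k * g s < e / 3" using k by (rule order_tendstoD)
    moreover have "\<forall>\<^sub>F s in at t. N (u k s - u k t) < e / 3"
      using continuous_into_tendsto[OF u UNIV_I] e by (intro order_tendstoD[where y = 0]) auto
    ultimately show "\<forall>\<^sub>F s in at t. dist (N (w s - w t)) 0 < e"
    proof eventually_elim
      case (elim s)
      have "N (w s - w t) \<le> N (w s - u k s) + N (u k s - w t)" by (intro N_triangle w um)
      also have "N (u k s - w t) \<le> N (u k s - u k t) + N (u k t - w t)" by (intro N_triangle w um)
      finally have "N (w s - w t) < e"
        using le[of k s] le[of k t] k elim N_minus_commute[OF w um, of s k s] by linarith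
      then show ?case using N_nonneg[OF diff_mem[OF w w]] by simp
    qed
  qed
qed

end

locale lipschitz_field = fatou_norm +
  fixes K :: "('i \<Rightarrow> complex) \<Rightarrow> 'i \<Rightarrow> complex" and L :: real
  assumes K_mem: "x \<in> X \<Longrightarrow> K x \<in> X"
    and K_lipschitz: "x \<in> X \<Longrightarrow> y \<in> X \<Longrightarrow> N (K x - K y) \<le> L * N (x - y)"
    and L_pos: "L > 0"
begin

section \<open>Picard iteration and stability of the flow\<close>

lemma continuous_into_K: "continuous_into X N S u \<Longrightarrow> continuous_into X N S (\<lambda>s. K (u s))"
  by (rule continuous_into_compare[where L = L]) (auto intro: K_mem K_lipschitz continuous_into_mem)

text \<open>One Picard step. Each coordinate has an antiderivative on the whole line, and
  \<open>continuous_into_primitive\<close> shows that together they form a curve in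
  \<open>X\<close>.\<close>

lemma primitive_exists:
  assumes w: "continuous_into X N UNIV w" and x0: "x0 \<in> X"
  shows "\<exists>v. continuous_into X N UNIV v \<and> v 0 = x0 \<and>
    (\<forall>t n. ((\<lambda>s. v s n) has_vector_derivative K (w t) n) (at t))"
proof -
  have "\<exists>F. \<forall>t. (F has_vector_derivative K (w t) n) (at t)" for n
    using einterval_antiderivative[of "-\<infinity>" \<infinity> "\<lambda>t. K (w t) n"]
      continuous_into_component[OF continuous_into_K[OF w], of n]
    by (simp add: continuous_on_eq_continuous_at)
  then have "\<exists>F. \<forall>n t. (F n has_vector_derivative K (w t) n) (at t)" by (intro choice) blast
  then obtain F where F: "\<And>n t. (F n has_vector_derivative K (w t) n) (at t)" by blast
  define v where "v t n = x0 n + (F n t - F n 0)" for t n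
  have der: "((\<lambda>s. v s n) has_vector_derivative K (w t) n) (at t)" for t n
    unfolding v_def by (auto intro!: derivative_eq_intros F)
  have v0: "v 0 = x0" by (auto simp: v_def)
  have "continuous_into X N UNIV v"
    by (rule continuous_into_primitive[OF continuous_into_K[OF w] der]) (simp add: v0 x0)
  with v0 der show ?thesis by (intro exI[of _ v] conjI allI)
qed

text \<open>The derivative of \<open>v1 - v2\<close> is \<open>K (w1 t) - K (w2 t)\<close>, which
  the Lipschitz bound places under the hypothesis of \<open>increment_bound_exp\<close>; the term
  \<open>- 1\<close> in its conclusion is dropped.\<close>

lemma picard_contraction:
  assumes w1: "continuous_into X N UNIV w1" and w2: "continuous_into X N UNIV w2"
    and d1: "\<And>t n. ((\<lambda>s. v1 s n) has_vector_derivative K (w1 t) n) (at t)"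
    and d2: "\<And>t n. ((\<lambda>s. v2 s n) has_vector_derivative K (w2 t) n) (at t)"
    and init: "v1 0 = v2 0"
    and le: "\<And>s. N (w1 s - w2 s) \<le> C * exp (2 * L * \<bar>s\<bar>)"
  shows "N (v1 t - v2 t) \<le> C / 2 * exp (2 * L * \<bar>t\<bar>)"
proof -
  note m1 = continuous_into_mem[OF w1 UNIV_I] and m2 = continuous_into_mem[OF w2 UNIV_I]
  have C: "C \<ge> 0" using le[of 0] N_nonneg[OF diff_mem[OF m1[of 0] m2[of 0]]] by simp
  have "N ((v1 t - v2 t) - (v1 0 - v2 0)) \<le> C / 2 * (exp (2 * L * \<bar>t\<bar>) - 1)"
  proof (rule increment_bound_exp[THEN conjunct2, OF _ _ _ C])
    show "((\<lambda>r. (v1 r - v2 r) n) has_vector_derivative (K (w1 s) - K (w2 s)) n)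
        (at s within closed_segment 0 t)" for s n
      unfolding minus_apply
      by (intro has_vector_derivative_diff has_vector_derivative_at_within[OF d1]
          has_vector_derivative_at_within[OF d2])
    show "continuous_into X N (closed_segment 0 t) (\<lambda>s. K (w1 s) - K (w2 s))"
      by (intro continuous_into_diff continuous_into_K continuous_into_subset[OF w1]
          continuous_into_subset[OF w2]) auto
    show "N (K (w1 s) - K (w2 s)) \<le> L * (C * exp (2 * L * \<bar>s\<bar>))" for s
      using K_lipschitz[OF m1 m2, of s s] mult_left_mono[OF le[of s] less_imp_le[OF L_pos]] by linarith
  qed
  moreover have "(v1 t - v2 t) - (v1 0 - v2 0) = v1 t - v2 t" using init by (auto simp: fun_eq_iff)
  ultimately show ?thesis using C by (simp add: algebra_simps)
qed

text \<open>The weight \<open>exp (2 L |t|)\<close> makes the Picard map contract by \<open>1/2\<close> on the whole line.\<close>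

lemma global_flow:
  assumes x0: "x0 \<in> X"
  shows "\<exists>w. continuous_into X N UNIV w \<and> w 0 = x0 \<and>
    (\<forall>t n. ((\<lambda>s. w s n) has_vector_derivative K (w t) n) (at t))"
proof -
  \<comment> \<open>The clause for \<open>k = 0\<close> makes the iteration start at the constant
    curve, which the choice principle would otherwise not record.\<close>
  define P where "P k w \<longleftrightarrow> continuous_into X N UNIV w \<and> w 0 = x0 \<and> (k = 0 \<longrightarrow> w = (\<lambda>_. x0))"
    for k :: nat and w
  define Q where "Q w v \<longleftrightarrow> (\<forall>t n. ((\<lambda>s. v s n) has_vector_derivative K (w t) n) (at t))"
    for w v :: "real \<Rightarrow> 'i \<Rightarrow> complex"
  have "\<exists>w. \<forall>k. P k (w k) \<and> Q (w k) (w (Suc k))"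
  proof (rule dependent_nat_choice[where P = P and Q = "\<lambda>_. Q"])
    show "\<exists>w. P 0 w" using x0 by (auto simp: P_def continuous_into_const)
    show "\<exists>v. P (Suc k) v \<and> Q w v" if "P k w" for w k
      using primitive_exists[OF _ x0] that unfolding P_def Q_def by blast
  qed
  then obtain w where w: "\<And>k. continuous_into X N UNIV (w k)" "\<And>k. w k 0 = x0" "\<And>t. w 0 t = x0"
    and der: "\<And>k t n. ((\<lambda>s. w (Suc k) s n) has_vector_derivative K (w k t) n) (at t)"
    unfolding P_def Q_def by metis
  note wm = continuous_into_mem[OF w(1) UNIV_I]
  define E where "E t = exp (2 * L * \<bar>t\<bar>)" for t :: real
  have E: "E t \<ge> 1" for t using L_pos by (simp add: E_def)
  \<comment> \<open>The first step has norm at most \<open>N (K x0) * \<bar>t\<bar>\<close>, that is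
    \<open>D * (L * \<bar>t\<bar>)\<close>, and \<open>L * \<bar>t\<bar>\<close> is below the weight
    \<open>E t\<close>.\<close>
  define D where "D = N (K x0) / L"
  have D: "D \<ge> 0" using N_nonneg[OF K_mem[OF x0]] L_pos by (simp add: D_def)
  have base: "N (w (Suc 0) t - w 0 t) \<le> D * E t" for t
  proof -
    have "N (w (Suc 0) t - w (Suc 0) 0) \<le> N (K x0) * \<bar>t - 0\<bar>"
    proof (rule increment_bound_const[THEN conjunct2])
      show "((\<lambda>r. w (Suc 0) r n) has_vector_derivative K (w 0 s) n) (at s within closed_segment 0 t)" for s n
        by (rule has_vector_derivative_at_within[OF der])
      show "continuous_into X N (closed_segment 0 t) (\<lambda>s. K (w 0 s))"
        by (intro continuous_into_K continuous_into_subset[OF w(1)]) auto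
    qed (simp add: w(3))
    also have "\<dots> = D * (L * \<bar>t\<bar>)" using L_pos by (simp add: D_def)
    also have "\<dots> \<le> D * E t"
    proof (rule mult_left_mono[OF _ D])
      have "0 \<le> L * \<bar>t\<bar>" using L_pos by simp
      then show "L * \<bar>t\<bar> \<le> E t" using exp_ge_add_one_self[of "2 * L * \<bar>t\<bar>"] unfolding E_def by linarith
    qed
    finally show ?thesis by (simp only: w(2,3))
  qed
  have step: "N (w (Suc k) t - w k t) \<le> D * (1/2) ^ k * E t" for k t
  proof (induction k arbitrary: t)
    case 0 show ?case unfolding power_0 mult_1_right by (rule base)
  next
    case (Suc k)
    have "N (w (Suc (Suc k)) t - w (Suc k) t) \<le> D * (1/2) ^ k / 2 * exp (2 * L * \<bar>t\<bar>)"
      by (rule picard_contraction[OF w(1) w(1) der der]) (unfold w(2), rule refl, rule Suc[unfolded E_def])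
    also have "\<dots> = D * (1/2) ^ Suc k * E t" by (simp add: E_def)
    finally show ?case .
  qed
  have "\<exists>y\<in>X. \<forall>k. N (w k t - y) \<le> 2 * (D * E t) * (1/2) ^ k" for t
    by (rule geometric_limit[OF wm]) (use step[of _ t] in \<open>simp add: mult_ac\<close>)
  then obtain z where zm: "\<And>t. z t \<in> X" and z: "\<And>t k. N (w k t - z t) \<le> 2 * (D * E t) * (1/2) ^ k"
    by metis
  have z': "N (w k t - z t) \<le> (2 * D * (1/2) ^ k) * E t" for k t using z[of k t] by (simp add: mult_ac)
  have pow: "(\<lambda>k. c * (1/2 :: real) ^ k) \<longlonglongrightarrow> 0" for c :: real
    using tendsto_mult_right_zero[OF LIMSEQ_realpow_zero[of "1/2"]] by simp
  have zc: "continuous_into X N UNIV z"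
    by (rule continuous_into_locally_uniform_limit[OF w(1) zm z' pow])
      (auto simp: E_def intro!: continuous_intros)
  obtain v where vc: "continuous_into X N UNIV v" and v0: "v 0 = x0"
    and vd: "\<And>t n. ((\<lambda>s. v s n) has_vector_derivative K (z t) n) (at t)"
    using primitive_exists[OF zc x0] by metis
  note vm = continuous_into_mem[OF vc UNIV_I]
  \<comment> \<open>\<open>v\<close> is the Picard image of the limit \<open>z\<close>. Both
    \<open>v t\<close> and \<open>z t\<close> lie within \<open>D * (1/2) ^ k * E t\<close> of
    \<open>w (Suc k) t\<close>, so \<open>z\<close> is a fixed point.\<close>
  have "v t = z t" for t
  proof -
    have "N (v t - z t) \<le> 2 * (D * E t) * (1/2) ^ k" for k
    proof -
      have "N (w (Suc k) t - v t) \<le> (2 * D * (1/2) ^ k) / 2 * exp (2 * L * \<bar>t\<bar>)"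
        by (rule picard_contraction[OF w(1) zc der vd]) (use z' in \<open>auto simp: w v0 E_def\<close>)
      moreover have "N (v t - z t) \<le> N (v t - w (Suc k) t) + N (w (Suc k) t - z t)"
        by (intro N_triangle vm wm zm)
      ultimately show ?thesis
        using z[of "Suc k" t] N_minus_commute[OF vm wm, of t "Suc k" t] by (simp add: E_def mult_ac)
    qed
    then have "N (v t - z t) \<le> 0" using LIMSEQ_le_const[OF pow] by blast
    then have "v t - z t = 0" by (rule N_eq_zero[OF diff_mem[OF vm zm]])
    then show ?thesis by simp
  qed
  then have "v = z" by blast
  with vc v0 vd show ?thesis by (intro exI[of _ z] conjI allI) simp_all
qed

text \<open>A substitute for Gronwall's inequality: the weighted difference \<open>m\<close> attains
  its maximum at some \<open>q\<close>, and the increment bound up to \<open>q\<close> returns only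
  half of \<open>m q\<close>, which is absorbed on the left. The absorption costs the factor
  \<open>2\<close>.\<close>

lemma flow_stability:
  assumes u: "continuous_into X N (closed_segment 0 T) u" and v: "continuous_into X N (closed_segment 0 T) v"
    and du: "\<And>t n. t \<in> closed_segment 0 T \<Longrightarrow>
      ((\<lambda>s. u s n) has_vector_derivative K (u t) n) (at t within closed_segment 0 T)"
    and dv: "\<And>t n. t \<in> closed_segment 0 T \<Longrightarrow>
      ((\<lambda>s. v s n) has_vector_derivative K (v t) n) (at t within closed_segment 0 T)"
  shows "N (u T - v T) \<le> 2 * N (u 0 - v 0) * exp (2 * L * \<bar>T\<bar>)"
proof -
  let ?S = "closed_segment 0 T"
  note um = continuous_into_mem[OF u] and vm = continuous_into_mem[OF v]
  define m where "m s = N (u s - v s) * exp (- 2 * L * \<bar>s\<bar>)" for s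
  have "continuous_on ?S m"
    unfolding m_def by (intro continuous_intros continuous_on_N continuous_into_diff u v)
  then obtain q where q: "q \<in> ?S" "\<And>s. s \<in> ?S \<Longrightarrow> m s \<le> m q"
    using continuous_attains_sup[of ?S m] by auto
  have expand: "N (u s - v s) = m s * exp (2 * L * \<bar>s\<bar>)" for s
    by (simp add: m_def exp_minus)
  have nn: "m q \<ge> 0" unfolding m_def using N_nonneg[OF diff_mem[OF um vm]] q by simp
  have sub: "closed_segment 0 q \<subseteq> ?S" using q by (simp add: subset_closed_segment)
  have "N ((u q - v q) - (u 0 - v 0)) \<le> m q / 2 * (exp (2 * L * \<bar>q\<bar>) - 1)"
  proof (rule increment_bound_exp[THEN conjunct2, OF _ _ _ nn])
    show "((\<lambda>r. (u r - v r) n) has_vector_derivative (K (u s) - K (v s)) n)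
        (at s within closed_segment 0 q)" if "s \<in> closed_segment 0 q" for s n
      unfolding minus_apply using that sub
      by (intro has_vector_derivative_diff has_vector_derivative_within_subset[OF du sub]
          has_vector_derivative_within_subset[OF dv sub]) auto
    show "continuous_into X N (closed_segment 0 q) (\<lambda>s. K (u s) - K (v s))"
      by (intro continuous_into_diff continuous_into_K continuous_into_subset[OF u sub]
          continuous_into_subset[OF v sub])
    show "N (K (u s) - K (v s)) \<le> L * (m q * exp (2 * L * \<bar>s\<bar>))" if "s \<in> closed_segment 0 q" for s
    proof -
      have s: "s \<in> ?S" using that sub by blast
      have "N (K (u s) - K (v s)) \<le> L * N (u s - v s)" by (rule K_lipschitz[OF um[OF s] vm[OF s]])
      also have "\<dots> \<le> L * (m q * exp (2 * L * \<bar>s\<bar>))"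
        unfolding expand using q(2)[OF s] L_pos by simp
      finally show ?thesis .
    qed
  qed
  moreover have "N (u q - v q) \<le> N (u 0 - v 0) + N ((u q - v q) - (u 0 - v 0))"
    by (intro N_triangle_le diff_mem um vm q) auto
  ultimately have "m q * exp (2 * L * \<bar>q\<bar>) \<le> N (u 0 - v 0) + m q / 2 * exp (2 * L * \<bar>q\<bar>)"
    using nn expand[of q] by (simp add: algebra_simps)
  then have "m q * exp (2 * L * \<bar>q\<bar>) \<le> 2 * N (u 0 - v 0)" by simp
  moreover have "m q * 1 \<le> m q * exp (2 * L * \<bar>q\<bar>)" using nn L_pos by (intro mult_left_mono) auto
  ultimately have "m T \<le> 2 * N (u 0 - v 0)" using q(2)[of T] by simp
  then show ?thesis unfolding expand[of T] by simp
qed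

end

section \<open>Equations that can be truncated to Lipschitz ones\<close>

lemma is_interval_closed_segment_subset:
  fixes I :: "real set"
  assumes "is_interval I" "a \<in> I" "b \<in> I"
  shows "closed_segment a b \<subseteq> I"
  using assms by (simp add: is_interval_convex_1 closed_segment_subset)

lemma is_interval_einterval: "is_interval (einterval a b)"
  unfolding is_interval_1
proof (intro ballI allI impI)
  fix x y z assume x: "x \<in> einterval a b" and y: "y \<in> einterval a b" and z: "x \<le> z \<and> z \<le> y"
  have "a < ereal z" using x z order_less_le_trans[of a "ereal x" "ereal z"] by (simp add: einterval_iff)
  moreover have "ereal z < b" using y z order_le_less_trans[of "ereal z" "ereal y" b] by (simp add: einterval_iff)
  ultimately show "z \<in> einterval a b" by (simp add: einterval_iff)
qed

lemma zero_mem_einterval: "0 < Tmin \<Longrightarrow> 0 < Tmax \<Longrightarrow> 0 \<in> einterval (- Tmin) Tmax"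
  by (simp add: einterval_iff zero_ereal_def[symmetric] ereal_uminus_less_reorder)

text \<open>\<open>eqn_iff\<close> is restricted to curves in \<open>X\<close> because the concrete
  equation is imposed only at lattice points; membership in \<open>X\<close> is what settles the
  other coordinates.\<close>

locale truncatable_equation = fatou_norm +
  fixes G :: "('i \<Rightarrow> complex) \<Rightarrow> 'i \<Rightarrow> complex"
    and eqn :: "real set \<Rightarrow> (real \<Rightarrow> 'i \<Rightarrow> complex) \<Rightarrow> bool"
  assumes truncation: "\<And>R. \<exists>K L. lipschitz_field X N K L \<and> (\<forall>x\<in>X. N x \<le> R \<longrightarrow> K x = G x)"
    and eqn_iff: "\<And>I u. (\<And>t. t \<in> I \<Longrightarrow> u t \<in> X) \<Longrightarrow>
      eqn I u \<longleftrightarrow> (\<forall>t\<in>I. \<forall>n. ((\<lambda>s. u s n) has_vector_derivative G (u t) n) (at t within I))"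
begin

section \<open>Solutions as trajectories of truncated flows\<close>

abbreviation "sol \<equiv> strong_solution X N eqn"

lemma sol_iff:
  "sol u0 I u \<longleftrightarrow> continuous_into X N I u \<and> u 0 = u0 \<and>
    (\<forall>t\<in>I. \<forall>n. ((\<lambda>s. u s n) has_vector_derivative G (u t) n) (at t within I))"
proof (cases "continuous_into X N I u")
  case True
  have e: "eqn I u \<longleftrightarrow> (\<forall>t\<in>I. \<forall>n. ((\<lambda>s. u s n) has_vector_derivative G (u t) n) (at t within I))"
    by (rule eqn_iff) (rule continuous_into_mem[OF True])
  show ?thesis unfolding strong_solution_def e by (intro iffI conjI; elim conjE; assumption)
qed (simp add: strong_solution_def)

text \<open>This covers sets \<open>J\<close> without \<open>0\<close> as well: the initial
  condition concerns \<open>u 0\<close> whether or not \<open>0\<close> lies in the time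
  set.\<close>

lemma sol_subset:
  assumes u: "sol u0 I u" and J: "J \<subseteq> I" shows "sol u0 J u"
proof -
  note u' = u[unfolded sol_iff]
  show ?thesis
    unfolding sol_iff
  proof (intro conjI ballI allI)
    show "continuous_into X N J u" by (rule continuous_into_subset[OF u'[THEN conjunct1] J])
    show "((\<lambda>s. u s n) has_vector_derivative G (u t) n) (at t within J)" if "t \<in> J" for t n
      by (rule has_vector_derivative_within_subset[OF _ J]) (rule u'[THEN conjunct2, THEN conjunct2, rule_format, OF subsetD[OF J that]])
  qed (rule u'[THEN conjunct2, THEN conjunct1])
qed

lemma sol_continuous: "sol u0 I u \<Longrightarrow> continuous_into X N I u"
  by (simp add: sol_iff)

lemma sol_mem: "sol u0 I u \<Longrightarrow> t \<in> I \<Longrightarrow> u t \<in> X"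
  by (rule continuous_into_mem[OF sol_continuous])

lemma sol_bounded:
  assumes "sol u0 I u" "compact I"
  shows "\<exists>B. \<forall>s\<in>I. N (u s) \<le> B"
  by (rule continuous_into_bounded[OF sol_continuous[OF assms(1)] assms(2)]) blast

text \<open>Collects what later arguments use of a truncated equation, so that its field is not
  mentioned again. The last two clauses relate flow and equation: a trajectory solves the equation
  while it is in the ball of radius \<open>R\<close>, and a solution follows the flow while it is in
  that ball.\<close>

definition truncated_flow :: "real \<Rightarrow> (('i \<Rightarrow> complex) \<Rightarrow> real \<Rightarrow> 'i \<Rightarrow> complex) \<Rightarrow> real \<Rightarrow> bool" where
  "truncated_flow R \<Phi> L \<longleftrightarrow> L > 0 \<and>
    (\<forall>x\<in>X. continuous_into X N UNIV (\<Phi> x)) \<and>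
    (\<forall>x\<in>X. \<forall>y\<in>X. \<forall>t. N (\<Phi> x t - \<Phi> y t) \<le> 2 * N (x - y) * exp (2 * L * \<bar>t\<bar>)) \<and>
    (\<forall>x\<in>X. \<forall>J. (\<forall>t\<in>J. N (\<Phi> x t) \<le> R) \<longrightarrow> sol x J (\<Phi> x)) \<and>
    (\<forall>x\<in>X. \<forall>I u t. sol x I u \<and> closed_segment 0 t \<subseteq> I \<and> (\<forall>s\<in>closed_segment 0 t. N (u s) \<le> R)
      \<longrightarrow> u t = \<Phi> x t)"

lemma
  assumes \<Phi>: "truncated_flow R \<Phi> L" and x: "x \<in> X"
  shows truncated_flow_pos: "L > 0"
    and truncated_flow_continuous: "continuous_into X N UNIV (\<Phi> x)"
    and truncated_flow_stability: "y \<in> X \<Longrightarrow> N (\<Phi> x t - \<Phi> y t) \<le> 2 * N (x - y) * exp (2 * L * \<bar>t\<bar>)"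
    and truncated_flow_sol: "(\<And>t. t \<in> J \<Longrightarrow> N (\<Phi> x t) \<le> R) \<Longrightarrow> sol x J (\<Phi> x)"
    and truncated_flow_unique: "sol x I u \<Longrightarrow> closed_segment 0 t \<subseteq> I \<Longrightarrow>
      (\<And>s. s \<in> closed_segment 0 t \<Longrightarrow> N (u s) \<le> R) \<Longrightarrow> u t = \<Phi> x t"
proof -
  note * = \<Phi>[unfolded truncated_flow_def]
  show "L > 0" using * by (elim conjE)
  show "continuous_into X N UNIV (\<Phi> x)" using * x by (elim conjE bspec)
  show "N (\<Phi> x t - \<Phi> y t) \<le> 2 * N (x - y) * exp (2 * L * \<bar>t\<bar>)" if "y \<in> X"
    by (rule *[THEN conjunct2, THEN conjunct2, THEN conjunct1, rule_format, OF x that])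
  show "sol x J (\<Phi> x)" if "\<And>t. t \<in> J \<Longrightarrow> N (\<Phi> x t) \<le> R"
    by (rule *[THEN conjunct2, THEN conjunct2, THEN conjunct2, THEN conjunct1, rule_format, OF x that])
  show "u t = \<Phi> x t"
    if "sol x I u" "closed_segment 0 t \<subseteq> I" "\<And>s. s \<in> closed_segment 0 t \<Longrightarrow> N (u s) \<le> R"
    by (rule *[THEN conjunct2, THEN conjunct2, THEN conjunct2, THEN conjunct2, rule_format, OF x])
      (rule conjI[OF that(1) conjI[OF that(2)]], intro ballI that(3))
qed

text \<open>\<open>\<Phi>\<close> is the global flow of a Lipschitz field \<open>K\<close> that
  agrees with \<open>G\<close> on the ball; the uniqueness clause is \<open>flow_stability\<close>
  for equal initial values.\<close>

lemma truncated_flow_exists: "\<exists>\<Phi> L. truncated_flow R \<Phi> L"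
proof -
  obtain K L where K: "lipschitz_field X N K L" and KG: "\<And>x. x \<in> X \<Longrightarrow> N x \<le> R \<Longrightarrow> K x = G x"
    using truncation by blast
  interpret K: lipschitz_field X N K L by (rule K)
  obtain \<Phi> where \<Phi>: "\<And>x. x \<in> X \<Longrightarrow> continuous_into X N UNIV (\<Phi> x)" "\<And>x. x \<in> X \<Longrightarrow> \<Phi> x 0 = x"
    and der: "\<And>x t n. x \<in> X \<Longrightarrow> ((\<lambda>s. \<Phi> x s n) has_vector_derivative K (\<Phi> x t) n) (at t)"
    using K.global_flow by metis
  have stab: "N (\<Phi> x t - \<Phi> y t) \<le> 2 * N (x - y) * exp (2 * L * \<bar>t\<bar>)" if "x \<in> X" "y \<in> X" for x y t
    using K.flow_stability[OF continuous_into_subset[OF \<Phi>(1)] continuous_into_subset[OF \<Phi>(1)]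
        has_vector_derivative_at_within[OF der] has_vector_derivative_at_within[OF der], of x t y] that
    by (simp add: \<Phi>(2))
  have solves: "sol x J (\<Phi> x)" if "x \<in> X" "\<forall>t\<in>J. N (\<Phi> x t) \<le> R" for x J
    unfolding sol_iff
  proof (intro conjI ballI allI)
    show "continuous_into X N J (\<Phi> x)" by (rule continuous_into_subset[OF \<Phi>(1)[OF that(1)]]) simp
    show "\<Phi> x 0 = x" by (rule \<Phi>(2)[OF that(1)])
    fix t n assume "t \<in> J"
    then have "K (\<Phi> x t) = G (\<Phi> x t)"
      using that continuous_into_mem[OF \<Phi>(1)[OF that(1)] UNIV_I] by (intro KG) auto
    then show "((\<lambda>s. \<Phi> x s n) has_vector_derivative G (\<Phi> x t) n) (at t within J)"
      using has_vector_derivative_at_within[OF der[OF that(1), of n t]] by simp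
  qed
  have unique: "u t = \<Phi> x t"
    if x: "x \<in> X" and u: "sol x I u" and sub: "closed_segment 0 t \<subseteq> I"
      and bd: "\<forall>s\<in>closed_segment 0 t. N (u s) \<le> R" for x I u t
  proof -
    have u': "sol x (closed_segment 0 t) u" by (rule sol_subset[OF u sub])
    then have uc: "continuous_into X N (closed_segment 0 t) u" by (simp add: sol_iff)
    have pc: "continuous_into X N (closed_segment 0 t) (\<Phi> x)"
      by (rule continuous_into_subset[OF \<Phi>(1)[OF x]]) simp
    have "N (u t - \<Phi> x t) \<le> 2 * N (u 0 - \<Phi> x 0) * exp (2 * L * \<bar>t\<bar>)"
    proof (rule K.flow_stability[OF uc pc])
      fix s n assume s: "s \<in> closed_segment 0 t"
      show "((\<lambda>s. u s n) has_vector_derivative K (u s) n) (at s within closed_segment 0 t)"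
        using u' s bd KG[of "u s"] continuous_into_mem[OF uc s] unfolding sol_iff by simp
      show "((\<lambda>s. \<Phi> x s n) has_vector_derivative K (\<Phi> x s) n) (at s within closed_segment 0 t)"
        by (rule has_vector_derivative_at_within[OF der[OF x]])
    qed
    moreover have "u 0 - \<Phi> x 0 = 0" using u x by (simp add: sol_iff \<Phi>(2))
    ultimately have "N (u t - \<Phi> x t) \<le> 0" by (simp add: N_zero)
    then have "u t - \<Phi> x t = 0"
      by (intro N_eq_zero diff_mem continuous_into_mem[OF uc] continuous_into_mem[OF pc]) auto
    then show ?thesis by simp
  qed
  show ?thesis
    unfolding truncated_flow_def
    by (rule exI[of _ \<Phi>], rule exI[of _ L], intro conjI ballI allI impI, rule K.L_pos,
        erule \<Phi>(1), erule (1) stab, erule (1) solves, elim conjE, erule (3) unique)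
qed

text \<open>The interval may be open or unbounded, so norms are bounded on the compact segment from
  \<open>0\<close> to \<open>t\<close>; truncation at the larger bound makes both solutions follow
  one flow.\<close>

lemma sol_unique:
  assumes u0: "u0 \<in> X" and I: "is_interval I" "0 \<in> I"
    and u: "sol u0 I u" and v: "sol u0 I v" and t: "t \<in> I"
  shows "u t = v t"
proof -
  let ?S = "closed_segment 0 t"
  have sub: "?S \<subseteq> I" by (rule is_interval_closed_segment_subset[OF I t])
  obtain A where A: "\<And>s. s \<in> ?S \<Longrightarrow> N (u s) \<le> A"
    using sol_bounded[OF sol_subset[OF u sub] compact_segment] by blast
  obtain B where B: "\<And>s. s \<in> ?S \<Longrightarrow> N (v s) \<le> B"
    using sol_bounded[OF sol_subset[OF v sub] compact_segment] by blast
  obtain \<Phi> L where \<Phi>: "truncated_flow (max A B) \<Phi> L" using truncated_flow_exists by blast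
  have "u t = \<Phi> u0 t"
    by (rule truncated_flow_unique[OF \<Phi> u0 u sub]) (use A in \<open>auto simp: le_max_iff_disj\<close>)
  moreover have "v t = \<Phi> u0 t"
    by (rule truncated_flow_unique[OF \<Phi> u0 v sub]) (use B in \<open>auto simp: le_max_iff_disj\<close>)
  ultimately show ?thesis by simp
qed

text \<open>The radius \<open>B + 1\<close> leaves a margin: on \<open>{a..b}\<close> the flow
  equals \<open>u\<close> and has norm at most \<open>B\<close>, and by continuity it stays in the
  larger ball slightly beyond both endpoints. The case \<open>a = b = 0\<close> is local
  existence.\<close>

lemma sol_extend:
  assumes u0: "u0 \<in> X" and u: "sol u0 {a..b} u" and ab: "a \<le> 0" "0 \<le> b"
  shows "\<exists>a' b' w. a' < a \<and> b < b' \<and> sol u0 {a'<..<b'} w"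
proof -
  obtain B where B: "\<And>s. s \<in> {a..b} \<Longrightarrow> N (u s) \<le> B"
    using sol_bounded[OF u compact_Icc] by blast
  obtain \<Phi> L where \<Phi>: "truncated_flow (B + 1) \<Phi> L" using truncated_flow_exists by blast
  note \<Phi>c = truncated_flow_continuous[OF \<Phi> u0]
  have in_ball: "N (\<Phi> u0 t) \<le> B" if t: "t \<in> {a..b}" for t
  proof -
    have sub: "closed_segment 0 t \<subseteq> {a..b}" using ab t by (intro closed_segment_subset) auto
    have "u t = \<Phi> u0 t" by (rule truncated_flow_unique[OF \<Phi> u0 u sub]) (use B sub in force)
    then show ?thesis using B[OF t] by simp
  qed
  have near: "\<exists>d>0. \<forall>s. dist s c < d \<longrightarrow> N (\<Phi> u0 s) < B + 1" if "c \<in> {a..b}" for c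
  proof -
    have "((\<lambda>s. N (\<Phi> u0 s)) \<longlongrightarrow> N (\<Phi> u0 c)) (at c)"
      using continuous_on_N[OF \<Phi>c] by (auto simp: continuous_on_def)
    moreover have *: "N (\<Phi> u0 c) < B + 1" using in_ball[OF that] by simp
    ultimately have "\<forall>\<^sub>F s in at c. N (\<Phi> u0 s) < B + 1" by (rule order_tendstoD)
    then show ?thesis unfolding eventually_at using * by (metis UNIV_I)
  qed
  obtain d where d: "d > 0" "\<And>s. dist s a < d \<Longrightarrow> N (\<Phi> u0 s) < B + 1"
    using near[of a] ab by auto
  obtain e where e: "e > 0" "\<And>s. dist s b < e \<Longrightarrow> N (\<Phi> u0 s) < B + 1"
    using near[of b] ab by auto
  have "sol u0 {a - d<..<b + e} (\<Phi> u0)"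
  proof (rule truncated_flow_sol[OF \<Phi> u0])
    fix t assume t: "t \<in> {a - d<..<b + e}"
    then consider "t \<in> {a..b}" | "dist t a < d" | "dist t b < e" by (force simp: dist_real_def)
    then show "N (\<Phi> u0 t) \<le> B + 1"
      by cases (use in_ball[of t] d(2)[of t] e(2)[of t] in auto)
  qed
  then show ?thesis using d(1) e(1) by (intro exI[of _ "a - d"] exI[of _ "b + e"]) auto
qed

text \<open>Limits within an open set are plain limits, so being a solution is a local property
  there. It permits gluing solutions along overlapping intervals.\<close>

lemma sol_open_cover:
  assumes U: "open U" and u0: "u 0 = u0"
    and loc: "\<And>t. t \<in> U \<Longrightarrow> \<exists>V v. open V \<and> t \<in> V \<and> sol u0 V v \<and> (\<forall>s\<in>V. u s = v s)"
  shows "sol u0 U u"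
proof -
  have *: "u t \<in> X \<and> ((\<lambda>s. N (u s - u t)) \<longlongrightarrow> 0) (at t within U) \<and>
      ((\<lambda>s. u s n) has_vector_derivative G (u t) n) (at t within U)" if t: "t \<in> U" for t n
  proof -
    obtain V v where "open V \<and> t \<in> V \<and> sol u0 V v \<and> (\<forall>s\<in>V. u s = v s)"
      using loc[OF t] by (elim exE)
    then have V: "open V" "t \<in> V" and v: "sol u0 V v" and eq: "\<And>s. s \<in> V \<Longrightarrow> u s = v s"
      by simp_all
    note atV = at_within_open[OF V(2,1)] and atU = at_within_open[OF t U]
    note vc = sol_continuous[OF v]
    have "((\<lambda>s. N (v s - v t)) \<longlongrightarrow> 0) (at t)"
      using continuous_into_tendsto[OF vc V(2)] unfolding atV .
    then have "((\<lambda>s. N (u s - u t)) \<longlongrightarrow> 0) (at t)"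
      by (rule Lim_transform_within_open[OF _ V]) (simp only: eq V(2))
    moreover have "((\<lambda>s. v s n) has_vector_derivative G (v t) n) (at t)"
      using v V(2) unfolding sol_iff atV[symmetric] by blast
    then have "((\<lambda>s. u s n) has_vector_derivative G (u t) n) (at t)"
      unfolding eq[OF V(2)] by (rule has_vector_derivative_transform_within_open[OF _ V]) (simp only: eq)
    moreover have "u t \<in> X" using continuous_into_mem[OF vc V(2)] unfolding eq[OF V(2)] .
    ultimately show ?thesis unfolding atU by blast
  qed
  show ?thesis
    unfolding sol_iff continuous_into_def
    by (intro conjI ballI allI u0 *[THEN conjunct1] *[THEN conjunct2, THEN conjunct1]
        *[THEN conjunct2, THEN conjunct2])
qed

section \<open>Largest and maximal solutions\<close>

lemma sol_singleton:
  assumes "u0 \<in> X" shows "sol u0 {0..0} (\<lambda>_. u0)"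
  unfolding sol_iff
proof (intro conjI ballI allI)
  show "continuous_into X N {0..0} (\<lambda>_. u0)" by (rule continuous_into_const[OF assms])
  fix t n assume "t \<in> {0..0 :: real}"
  then have bot: "at t within {0..0} = bot" by (simp add: at_within_def)
  show "((\<lambda>s. u0 n) has_vector_derivative G u0 n) (at t within {0..0})"
    unfolding has_vector_derivative_def has_derivative_def bot
    by (intro conjI bounded_linear_scaleR_left tendsto_bot)
qed simp

text \<open>The interval is the union of all open intervals around \<open>0\<close> that carry a
  solution. It also contains every closed or half-open one, since a solution that reaches an
  endpoint can be continued past it.\<close>

lemma largest_solution:
  assumes u0: "u0 \<in> X"
  obtains Tmin Tmax u where "0 < Tmin" "0 < Tmax" "sol u0 (einterval (- Tmin) Tmax) u"
    "\<And>J v. is_interval J \<Longrightarrow> 0 \<in> J \<Longrightarrow> sol u0 J v \<Longrightarrow> J \<subseteq> einterval (- Tmin) Tmax"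
proof -
  define S where "S = {(a, b). a < 0 \<and> 0 < b \<and> (\<exists>w. sol u0 {a<..<b} w)}"
  have "\<forall>p\<in>S. \<exists>w. sol u0 {fst p<..<snd p} w" by (auto simp: S_def)
  then obtain W where "\<forall>p\<in>S. sol u0 {fst p<..<snd p} (W p)" by (auto dest: bchoice)
  then have W: "a < 0 \<and> 0 < b \<and> sol u0 {a<..<b} (W (a, b))" if "(a, b) \<in> S" for a b
    using that by (force simp: S_def)
  \<comment> \<open>On the single time \<open>0\<close> the equation holds trivially, the filter of
    punctured neighbourhoods being trivial; extending this solution gives a first interval.\<close>
  obtain a0 b0 where S0: "(a0, b0) \<in> S"
    using sol_extend[OF u0 sol_singleton[OF u0]] unfolding S_def by force
  define Tmin where "Tmin = (SUP p\<in>S. ereal (- fst p))"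
  define Tmax where "Tmax = (SUP p\<in>S. ereal (snd p))"
  have "ereal (- a0) \<le> Tmin" "ereal b0 \<le> Tmax"
    unfolding Tmin_def Tmax_def using S0 by (auto intro!: SUP_upper2[of "(a0, b0)"])
  moreover have "0 < ereal (- a0)" "0 < ereal b0" using W[OF S0] by auto
  ultimately have pos: "0 < Tmin" "0 < Tmax" using less_le_trans by blast+
  let ?U = "einterval (- Tmin) Tmax"
  have U_iff: "t \<in> ?U \<longleftrightarrow> (\<exists>a b. (a, b) \<in> S \<and> a < t \<and> t < b)" for t
  proof -
    have up: "ereal t < Tmax \<longleftrightarrow> (\<exists>a b. (a, b) \<in> S \<and> t < b)"
      unfolding Tmax_def less_SUP_iff by force
    have lo: "- Tmin < ereal t \<longleftrightarrow> (\<exists>a b. (a, b) \<in> S \<and> a < t)"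
    proof -
      have "- Tmin < ereal t \<longleftrightarrow> ereal (- t) < Tmin"
        using ereal_uminus_less_reorder[of Tmin "ereal t"] by simp
      also have "\<dots> \<longleftrightarrow> (\<exists>a b. (a, b) \<in> S \<and> a < t)"
        unfolding Tmin_def less_SUP_iff by force
      finally show ?thesis .
    qed
    show ?thesis
    proof (cases "t \<ge> 0")
      \<comment> \<open>Only the endpoint on the side of \<open>t\<close> matters, because every
        interval in \<open>S\<close> contains \<open>0\<close>.\<close>
      case True
      then show ?thesis unfolding einterval_iff up lo using W by (meson order_less_le_trans)
    next
      case False
      then show ?thesis unfolding einterval_iff up lo using W by (smt (verit))
    qed
  qed
  have agree: "W (a, b) t = W (c, d) t"
    if "(a, b) \<in> S" "(c, d) \<in> S" "a < t" "t < b" "c < t" "t < d" for a b c d t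
  proof (rule sol_unique[OF u0, of "{max a c<..<min b d}"])
    show "sol u0 {max a c<..<min b d} (W (a, b))"
      by (rule sol_subset[of _ "{a<..<b}"]) (use W[OF that(1)] in auto)
    show "sol u0 {max a c<..<min b d} (W (c, d))"
      by (rule sol_subset[of _ "{c<..<d}"]) (use W[OF that(2)] in auto)
  qed (use that W[OF that(1)] W[OF that(2)] in \<open>auto simp: is_interval_1\<close>)
  \<comment> \<open>The value at \<open>t\<close> is read off from a chosen interval around
    \<open>t\<close>; by \<open>agree\<close> the choice does not affect it.\<close>
  obtain \<pi> where \<pi>: "\<And>t. t \<in> ?U \<Longrightarrow> \<pi> t \<in> S \<and> fst (\<pi> t) < t \<and> t < snd (\<pi> t)"
  proof -
    have "\<forall>t. \<exists>p. t \<in> ?U \<longrightarrow> p \<in> S \<and> fst p < t \<and> t < snd p" unfolding U_iff by force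
    then show ?thesis using that by metis
  qed
  define u where "u t = W (\<pi> t) t" for t
  have uW: "u t = W (a, b) t" if "(a, b) \<in> S" "a < t" "t < b" for a b t
  proof -
    have "t \<in> ?U" using that U_iff by blast
    then show ?thesis
      using agree[of "fst (\<pi> t)" "snd (\<pi> t)" a b t] \<pi>[of t] that unfolding u_def by simp
  qed
  have "u 0 = W (a0, b0) 0" by (rule uW[OF S0]) (use W[OF S0] in auto)
  then have "u 0 = u0" using W[OF S0] by (simp add: sol_iff)
  then have usol: "sol u0 ?U u"
  proof (rule sol_open_cover[rotated])
    fix t assume "t \<in> ?U"
    then obtain a b where ab: "(a, b) \<in> S" "a < t" "t < b" unfolding U_iff by blast
    then show "\<exists>V v. open V \<and> t \<in> V \<and> sol u0 V v \<and> (\<forall>s\<in>V. u s = v s)"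
      using uW[OF ab(1)] W[OF ab(1)] by (intro exI[of _ "{a<..<b}"] exI[of _ "W (a, b)"]) auto
  qed simp
  have "J \<subseteq> ?U" if J: "is_interval J" "0 \<in> J" and v: "sol u0 J v" for J v
  proof
    fix t assume t: "t \<in> J"
    \<comment> \<open>Extending beyond the compact interval spanned by \<open>0\<close> and
      \<open>t\<close> puts \<open>t\<close> into the interior of an interval from \<open>S\<close>,
      even if \<open>t\<close> is an endpoint of \<open>J\<close>.\<close>
    have "{min 0 t..max 0 t} \<subseteq> J"
      using is_interval_closed_segment_subset[OF J t] by (auto simp: closed_segment_eq_real_ivl split: if_splits)
    from sol_extend[OF u0 sol_subset[OF v this]]
    obtain a b w where "a < min 0 t" "max 0 t < b" "sol u0 {a<..<b} w" by auto
    then have "(a, b) \<in> S \<and> a < t \<and> t < b" unfolding S_def by auto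
    then show "t \<in> ?U" unfolding U_iff by blast
  qed
  then show ?thesis by (rule that[OF pos usol])
qed

text \<open>\<open>maximal_solution\<close> only excludes proper extensions of \<open>u\<close>
  itself. Comparison with the largest solution turns this into control of the interval of every
  solution with the same initial value.\<close>

lemma maximal_solution_largest:
  assumes u0: "u0 \<in> X" and T: "0 < Tmin" "0 < Tmax"
    and u: "maximal_solution X N eqn u0 (einterval (- Tmin) Tmax) u"
    and J: "is_interval J" "0 \<in> J" "sol u0 J v"
  shows "J \<subseteq> einterval (- Tmin) Tmax"
proof -
  let ?I = "einterval (- Tmin) Tmax"
  have I: "is_interval ?I" "0 \<in> ?I" "sol u0 ?I u"
    using T u by (auto simp: is_interval_einterval maximal_solution_def intro: zero_mem_einterval)
  obtain S1 S2 w where "0 < S1" "0 < S2" and w: "sol u0 (einterval (- S1) S2) w"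
    and lar: "\<And>J v. is_interval J \<Longrightarrow> 0 \<in> J \<Longrightarrow> sol u0 J v \<Longrightarrow> J \<subseteq> einterval (- S1) S2"
    by (rule largest_solution[OF u0]) (rule that)
  have sub: "?I \<subseteq> einterval (- S1) S2" by (rule lar[OF I])
  have eq: "\<forall>t\<in>?I. w t = u t" by (intro ballI sol_unique[OF u0 I(1,2) sol_subset[OF w sub] I(3)])
  from u have mx: "is_interval J \<and> ?I \<subseteq> J \<and> sol u0 J v \<and> (\<forall>t\<in>?I. v t = u t) \<longrightarrow> J = ?I" for J v
    unfolding maximal_solution_def by (elim conjE allE)
  have "einterval (- S1) S2 = ?I"
    by (rule mx[of "einterval (- S1) S2" w, THEN mp]) (intro conjI is_interval_einterval sub w eq)
  then show ?thesis using lar[OF J] by simp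
qed

text \<open>The perturbed flow stays within \<open>min e 1\<close> of \<open>u\<close>: the
  \<open>1\<close> keeps it in the ball of radius \<open>B + 1\<close>, where it is a genuine
  solution, and \<open>e\<close> is the required accuracy. \<open>C\<close> is the stability
  constant at the largest \<open>\<bar>t\<bar>\<close> in \<open>{a..b}\<close>.\<close>

lemma continuous_dependence_compact:
  assumes u0: "u0 \<in> X" and us0: "\<And>k :: nat. us0 k \<in> X" and conv: "(\<lambda>k. N (us0 k - u0)) \<longlonglongrightarrow> 0"
    and u: "sol u0 {a..b} u" and ab: "a \<le> 0" "0 \<le> b" and e: "e > 0"
  shows "\<forall>\<^sub>F k in sequentially. \<exists>w. sol (us0 k) {a..b} w \<and> (\<forall>t\<in>{a..b}. N (w t - u t) < e)"
proof -
  obtain B where B: "\<And>s. s \<in> {a..b} \<Longrightarrow> N (u s) \<le> B"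
    using sol_bounded[OF u compact_Icc] by blast
  obtain \<Phi> L where \<Phi>: "truncated_flow (B + 1) \<Phi> L" using truncated_flow_exists by blast
  note L = truncated_flow_pos[OF \<Phi> u0]
  have eq: "u t = \<Phi> u0 t" if t: "t \<in> {a..b}" for t
  proof -
    have sub: "closed_segment 0 t \<subseteq> {a..b}" using ab t by (intro closed_segment_subset) auto
    show ?thesis by (rule truncated_flow_unique[OF \<Phi> u0 u sub]) (use B sub in force)
  qed
  define C where "C = 2 * exp (2 * L * max (- a) b)"
  have "(\<lambda>k. N (us0 k - u0) * C) \<longlonglongrightarrow> 0" by (rule tendsto_mult_left_zero[OF conv])
  then have "\<forall>\<^sub>F k in sequentially. N (us0 k - u0) * C < min e 1"
    using e by (intro order_tendstoD) auto
  then show ?thesis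
  proof eventually_elim
    case (elim k)
    have close: "N (\<Phi> (us0 k) t - u t) < min e 1" if t: "t \<in> {a..b}" for t
    proof -
      have nn: "0 \<le> N (us0 k - u0)" by (intro N_nonneg diff_mem us0 u0)
      have "N (\<Phi> (us0 k) t - u t) \<le> 2 * N (us0 k - u0) * exp (2 * L * \<bar>t\<bar>)"
        using truncated_flow_stability[OF \<Phi> us0 u0] eq[OF t] by simp
      also have "\<dots> \<le> 2 * N (us0 k - u0) * exp (2 * L * max (- a) b)"
        using nn L t by (intro mult_left_mono) auto
      also have "\<dots> = N (us0 k - u0) * C" by (simp add: C_def)
      finally show ?thesis using elim by linarith
    qed
    have "sol (us0 k) {a..b} (\<Phi> (us0 k))"
    proof (rule truncated_flow_sol[OF \<Phi> us0])
      fix t assume t: "t \<in> {a..b}"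
      have "N (\<Phi> (us0 k) t) \<le> N (u t) + N (\<Phi> (us0 k) t - u t)"
        by (intro N_triangle_le sol_mem[OF u t] continuous_into_mem[OF truncated_flow_continuous[OF \<Phi> us0] UNIV_I])
      then show "N (\<Phi> (us0 k) t) \<le> B + 1" using close[OF t] B[OF t] by linarith
    qed
    then show ?case using close by (intro exI[of _ "\<Phi> (us0 k)"]) auto
  qed
qed

theorem locally_well_posed_eqn: "locally_well_posed X N eqn"
  unfolding locally_well_posed_def
proof (intro conjI)
  show "unconditional_uniqueness X N eqn"
    unfolding unconditional_uniqueness_def
    by (intro ballI allI impI, elim conjE) (rule sol_unique)
  show "maximal_existence X N eqn"
    unfolding maximal_existence_def
  proof
    fix u0 assume u0: "u0 \<in> X"
    obtain Tmin Tmax u where T: "0 < Tmin" "0 < Tmax" and u: "sol u0 (einterval (- Tmin) Tmax) u"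
      and lar: "\<And>J v. is_interval J \<Longrightarrow> 0 \<in> J \<Longrightarrow> sol u0 J v \<Longrightarrow> J \<subseteq> einterval (- Tmin) Tmax"
      by (rule largest_solution[OF u0]) (rule that)
    have "0 \<in> einterval (- Tmin) Tmax"
      by (rule zero_mem_einterval[OF T])
    then have "maximal_solution X N eqn u0 (einterval (- Tmin) Tmax) u"
      unfolding maximal_solution_def
      by (intro conjI allI impI u) (elim conjE, rule subset_antisym, rule lar, auto)
    with T show "\<exists>Tmin Tmax u. 0 < Tmin \<and> 0 < Tmax \<and> maximal_solution X N eqn u0 (einterval (- Tmin) Tmax) u"
      by (intro exI conjI)
  qed
  show "continuous_dependence X N eqn"
    unfolding continuous_dependence_def
  proof (intro ballI allI impI, elim conjE)
    fix u0 Tmin Tmax u us0 Tmins Tmaxs us and a b :: real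
    assume u0: "u0 \<in> X" and T: "0 < Tmin" "0 < Tmax"
      and u: "maximal_solution X N eqn u0 (einterval (- Tmin) Tmax) u"
      and us: "\<forall>k. us0 k \<in> X \<and> 0 < Tmins k \<and> 0 < Tmaxs k \<and>
        maximal_solution X N eqn (us0 k) (einterval (- Tmins k) (Tmaxs k)) (us k)"
      and conv: "(\<lambda>k. N (us0 k - u0)) \<longlonglongrightarrow> 0"
      and sub: "{a..b} \<subseteq> einterval (- Tmin) Tmax"
    let ?I = "einterval (- Tmin) Tmax" and ?I' = "\<lambda>k. einterval (- Tmins k) (Tmaxs k)"
    show "(\<forall>\<^sub>F k in sequentially. {a..b} \<subseteq> ?I' k) \<and>
        (\<forall>\<epsilon>>0. \<forall>\<^sub>F k in sequentially. \<forall>t\<in>{a..b}. N (us k t - u t) < \<epsilon>)"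
    proof (cases "a \<le> b")
      case False then show ?thesis by simp
    next
      case True
      \<comment> \<open>\<open>{a..b}\<close> may miss the initial time, so it is enlarged to an
        interval that contains it.\<close>
      define c d where "c = min a 0" and "d = max b 0"
      have cd: "c \<le> 0" "0 \<le> d" "{a..b} \<subseteq> {c..d}" by (auto simp: c_def d_def)
      have zero: "0 \<in> ?I" by (rule zero_mem_einterval[OF T])
      have "c \<in> ?I" "d \<in> ?I" using sub True zero by (auto simp: c_def d_def min_def max_def)
      then have "{c..d} \<subseteq> ?I"
        using is_interval_closed_segment_subset[OF is_interval_einterval] cd
        by (metis closed_segment_eq_real_ivl order_trans)
      then have ucd: "sol u0 {c..d} u"
        using u unfolding maximal_solution_def by (elim conjE) (rule sol_subset)
      have main: "\<forall>\<^sub>F k in sequentially. {c..d} \<subseteq> ?I' k \<and> (\<forall>t\<in>{c..d}. N (us k t - u t) < \<epsilon>)"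
        if e: "\<epsilon> > 0" for \<epsilon>
        using continuous_dependence_compact[OF u0 _ conv ucd cd(1,2) e, OF us[rule_format, THEN conjunct1]]
      proof eventually_elim
        case (elim k)
        then obtain w where w': "sol (us0 k) {c..d} w \<and> (\<forall>t\<in>{c..d}. N (w t - u t) < \<epsilon>)"
          by (elim exE)
        note w = w'[THEN conjunct1] and close = w'[THEN conjunct2]
        have k: "us0 k \<in> X" "0 < Tmins k" "0 < Tmaxs k" "maximal_solution X N eqn (us0 k) (?I' k) (us k)"
          using us[rule_format, of k] by simp_all
        have int: "is_interval {c..d}" "0 \<in> {c..d}" using cd by (auto simp: is_interval_cc)
        \<comment> \<open>The existence of \<open>w\<close> forces the maximal interval of
          \<open>us k\<close> to contain \<open>{c..d}\<close>; uniqueness then identifies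
          \<open>us k\<close> with \<open>w\<close> there.\<close>
        have sub': "{c..d} \<subseteq> ?I' k" by (rule maximal_solution_largest[OF k int w])
        have "sol (us0 k) {c..d} (us k)"
          using k(4) unfolding maximal_solution_def by (elim conjE) (rule sol_subset[OF _ sub'])
        from sol_unique[OF k(1) int this w] have "us k t = w t" if "t \<in> {c..d}" for t
          using that .
        then show ?case using close sub' by simp
      qed
      show ?thesis
      proof (intro conjI allI impI)
        show "\<forall>\<^sub>F k in sequentially. {a..b} \<subseteq> ?I' k"
          using main[of 1] by (rule eventually_mono) (use cd(3) in auto)
        show "\<forall>\<^sub>F k in sequentially. \<forall>t\<in>{a..b}. N (us k t - u t) < \<epsilon>" if "\<epsilon> > 0" for \<epsilon>
          using main[OF that] by (rule eventually_mono) (use cd(3) in auto)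
      qed
    qed
  qed
qed

end

section \<open>Lattice sequence spaces\<close>

lemma lattice_add: "a \<in> lattice h \<Longrightarrow> b \<in> lattice h \<Longrightarrow> a + b \<in> lattice h"
  unfolding lattice_def by (simp, metis distrib_left of_int_add)

lemma lattice_diff: "a \<in> lattice h \<Longrightarrow> b \<in> lattice h \<Longrightarrow> a - b \<in> lattice h"
  unfolding lattice_def by (simp, metis right_diff_distrib of_int_diff)

lemma zero_in_lattice: "0 \<in> lattice h"
  unfolding lattice_def by (auto intro: exI[of _ 0])

lemma uminus_in_lattice: "a \<in> lattice h \<Longrightarrow> - a \<in> lattice h"
  using lattice_diff[OF zero_in_lattice] by simp

lemma step_in_lattice: "h *\<^sub>R axis j 1 \<in> lattice h"
  unfolding lattice_def
proof (clarify)
  fix i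
  show "\<exists>k::int. (h *\<^sub>R axis j 1) $ i = h * of_int k"
    by (rule exI[of _ "if i = j then 1 else 0"]) (simp add: axis_def)
qed

text \<open>The condition \<open>\<parallel>x\<parallel> \<le> C\<close> restricted to a finite set \<open>F\<close> of indices: membership and norm bounds
  in \<open>lp_space\<close> are equivalent to it for all finite \<open>F\<close>, which handles \<open>p < \<infinity>\<close> and \<open>p = \<infinity>\<close> at once.\<close>

definition lp_bound_on :: "ereal \<Rightarrow> 'i set \<Rightarrow> real \<Rightarrow> ('i \<Rightarrow> complex) \<Rightarrow> bool" where
  "lp_bound_on p F C x \<longleftrightarrow>
    (if p = \<infinity> then \<forall>n\<in>F. cmod (x n) \<le> C
     else (\<Sum>n\<in>F. cmod (x n) powr real_of_ereal p) \<le> C powr real_of_ereal p)"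

section \<open>Norm bounds through finite index sets\<close>

lemma real_of_ereal_ge_1: "1 \<le> p \<Longrightarrow> p \<noteq> \<infinity> \<Longrightarrow> 1 \<le> real_of_ereal p"
  by (cases p) auto

text \<open>For finite \<open>p\<close> the summands are nonnegative, so summability together with a
  bound on the sum amounts to that bound on all finite sums. \<open>C \<ge> 0\<close> allows the
  power \<open>C powr q\<close> to be undone.\<close>

lemma lp_bound_iff:
  fixes x :: "real ^ 'd \<Rightarrow> complex"
  assumes p: "1 \<le> p" and C: "C \<ge> 0"
  shows "x \<in> lp_space p h \<and> lp_norm p h x \<le> C \<longleftrightarrow>
    (\<forall>n. n \<notin> lattice h \<longrightarrow> x n = 0) \<and> (\<forall>F. finite F \<longrightarrow> F \<subseteq> lattice h \<longrightarrow> lp_bound_on p F C x)"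
proof (cases "p = \<infinity>")
  case True
  have "(bdd_above ((\<lambda>n. cmod (x n)) ` lattice h) \<and> (SUP n\<in>lattice h. cmod (x n)) \<le> C) \<longleftrightarrow>
      (\<forall>n\<in>lattice h. cmod (x n) \<le> C)" (is "?l \<longleftrightarrow> ?r")
  proof
    assume ?l then show ?r by (meson cSUP_upper order_trans)
  next
    assume ?r then show ?l using zero_in_lattice by (auto intro!: cSUP_least bdd_aboveI2)
  qed
  also have "\<dots> \<longleftrightarrow> (\<forall>F. finite F \<longrightarrow> F \<subseteq> lattice h \<longrightarrow> lp_bound_on p F C x)" (is "_ \<longleftrightarrow> ?r'")
  proof
    assume ?r'
    then have "lp_bound_on p {n} C x" if "n \<in> lattice h" for n using that by simp
    then show "\<forall>n\<in>lattice h. cmod (x n) \<le> C" using True by (simp add: lp_bound_on_def)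
  qed (auto simp: lp_bound_on_def True)
  finally show ?thesis using True unfolding lp_space_def lp_norm_def by auto
next
  case False
  define q where "q = real_of_ereal p"
  have q: "q \<ge> 1" using real_of_ereal_ge_1[OF p False] by (simp add: q_def)
  define f where "f n = cmod (x n) powr q" for n
  have "(f summable_on lattice h \<and> (infsum f (lattice h)) powr (1 / q) \<le> C) \<longleftrightarrow>
      (\<forall>F. finite F \<longrightarrow> F \<subseteq> (lattice h :: (real ^ 'd) set) \<longrightarrow> sum f F \<le> C powr q)" (is "?l \<longleftrightarrow> ?r")
  proof
    assume l: ?l
    have nn: "infsum f (lattice h) \<ge> 0" by (rule infsum_nonneg) (simp add: f_def)
    have "infsum f (lattice h) = (infsum f (lattice h) powr (1 / q)) powr q"
      using nn q by (simp add: powr_powr)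
    also have "\<dots> \<le> C powr q" using l q by (intro powr_mono2) auto
    finally have le: "infsum f (lattice h) \<le> C powr q" .
    show ?r
    proof (intro allI impI)
      fix F :: "(real ^ 'd) set" assume "finite F" "F \<subseteq> lattice h"
      then have "sum f F \<le> infsum f (lattice h)"
        using l by (intro finite_sum_le_infsum) (auto simp: f_def)
      then show "sum f F \<le> C powr q" using le by simp
    qed
  next
    assume r: ?r
    have s: "f summable_on lattice h"
      by (rule nonneg_bdd_above_summable_on) (use r in \<open>auto simp: f_def intro!: bdd_aboveI2[where M = "C powr q"]\<close>)
    have "infsum f (lattice h) \<le> C powr q" by (rule infsum_le_finite_sums[OF s]) (use r in auto)
    moreover have "infsum f (lattice h) \<ge> 0" by (rule infsum_nonneg) (simp add: f_def)
    ultimately have "infsum f (lattice h) powr (1 / q) \<le> (C powr q) powr (1 / q)"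
      using q by (intro powr_mono2) auto
    also have "\<dots> = C" using q C by (simp add: powr_powr)
    finally show ?l using s by simp
  qed
  then show ?thesis
    using False unfolding lp_space_def lp_norm_def lp_bound_on_def f_def q_def by auto
qed

lemma lp_norm_nonneg:
  assumes "x \<in> lp_space p h" shows "0 \<le> lp_norm p h x"
proof (cases "p = \<infinity>")
  case True
  have "cmod (x 0) \<le> (SUP n\<in>lattice h. cmod (x n))"
    using assms True by (intro cSUP_upper zero_in_lattice) (simp add: lp_space_def)
  with norm_ge_zero have "0 \<le> (SUP n\<in>lattice h. cmod (x n))" by (rule order_trans)
  then show ?thesis using True by (simp add: lp_norm_def)
qed (simp add: lp_norm_def)

lemma lp_bound_on_solid:
  assumes p: "1 \<le> p" and C: "C \<ge> 0" and c: "c \<ge> 0" and x: "lp_bound_on p F C x"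
    and le: "\<And>n. n \<in> F \<Longrightarrow> cmod (y n) \<le> c * cmod (x n)"
  shows "lp_bound_on p F (c * C) y"
proof (cases "p = \<infinity>")
  case True
  then show ?thesis using x le c unfolding lp_bound_on_def
    by (metis (full_types) mult_left_mono order_trans)
next
  case False
  define q where "q = real_of_ereal p"
  have q: "q \<ge> 1" using real_of_ereal_ge_1[OF p False] by (simp add: q_def)
  have "(\<Sum>n\<in>F. cmod (y n) powr q) \<le> (\<Sum>n\<in>F. c powr q * cmod (x n) powr q)"
    using q c le by (intro sum_mono) (simp add: powr_mono2 flip: powr_mult)
  also have "\<dots> = c powr q * (\<Sum>n\<in>F. cmod (x n) powr q)" by (simp add: sum_distrib_left)
  also have "\<dots> \<le> c powr q * C powr q"
    using x False by (intro mult_left_mono) (auto simp: lp_bound_on_def q_def)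
  finally show ?thesis using False c C by (simp add: lp_bound_on_def q_def powr_mult)
qed

text \<open>Convexity of the power at \<open>a / A\<close> and \<open>b / B\<close> with weights
  \<open>A / (A + B)\<close> and \<open>B / (A + B)\<close>. This is the termwise form of
  Minkowski's inequality, with \<open>A\<close> and \<open>B\<close> in the role of the two
  norms.\<close>

lemma powr_add_convex:
  fixes a b A B q :: real
  assumes q: "q \<ge> 1" and A: "A > 0" and B: "B > 0" and a: "a \<ge> 0" and b: "b \<ge> 0"
  shows "(a + b) powr q \<le> (A + B) powr q * (A / (A + B) * (a powr q / A powr q) + B / (A + B) * (b powr q / B powr q))"
proof -
  have conv: "(t * u + (1 - t) * v) powr q \<le> t * u powr q + (1 - t) * v powr q"
    if "0 < t" "t < 1" "0 \<le> u" "0 \<le> v" for t u v :: real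
  proof (cases "u = 0 \<or> v = 0")
    \<comment> \<open>If an argument is \<open>0\<close>, convexity reduces to
      \<open>s powr q \<le> s\<close> for \<open>0 < s < 1\<close>.\<close>
    case True
    have *: "(s * w) powr q \<le> s * w powr q" if "0 < s" "s < 1" "w \<ge> 0" for s w :: real
    proof -
      have "s powr q \<le> s powr 1" using that q by (intro powr_mono') auto
      then show ?thesis using that by (simp add: powr_mult mult_right_mono)
    qed
    show ?thesis using True *[of t u] *[of "1 - t" v] that q by auto
  next
    case False
    then show ?thesis
      using convex_onD[OF powr_convex[OF q], of t v u] that by (simp add: algebra_simps)
  qed
  define t where "t = A / (A + B)"
  have t: "0 < t" "t < 1" "1 - t = B / (A + B)" using A B by (auto simp: t_def field_simps)
  have "a + b = (A + B) * (t * (a / A) + (1 - t) * (b / B))"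
  proof -
    have "(A + B) * t = A" "(A + B) * (1 - t) = B" unfolding t(3) using A B by (simp_all add: t_def)
    then have "(A + B) * t * (a / A) + (A + B) * (1 - t) * (b / B) = a + b" using A B by simp
    then show ?thesis by (simp add: distrib_left mult.assoc)
  qed
  then have "(a + b) powr q = (A + B) powr q * (t * (a / A) + (1 - t) * (b / B)) powr q"
    using A B a b t by (simp add: powr_mult)
  also have "\<dots> \<le> (A + B) powr q * (t * (a / A) powr q + (1 - t) * (b / B) powr q)"
    using conv[of t "a / A" "b / B"] t A B a b by (intro mult_left_mono) auto
  finally show ?thesis using A B a b t by (simp add: powr_divide t_def)
qed

text \<open>After summing \<open>powr_add_convex\<close>, each of the two normalized sums is at most
  \<open>1\<close> and the weights add up to \<open>1\<close>.\<close>

lemma lp_bound_on_add: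
  assumes p: "1 \<le> p" and A: "A > 0" and B: "B > 0" and x: "lp_bound_on p F A x" and y: "lp_bound_on p F B y"
  shows "lp_bound_on p F (A + B) (x + y)"
proof (cases "p = \<infinity>")
  case True
  then show ?thesis using x y unfolding lp_bound_on_def
    by (simp add: add_mono norm_triangle_le)
next
  case False
  define q where "q = real_of_ereal p"
  have q: "q \<ge> 1" using real_of_ereal_ge_1[OF p False] by (simp add: q_def)
  have x': "(\<Sum>n\<in>F. cmod (x n) powr q) \<le> A powr q" and y': "(\<Sum>n\<in>F. cmod (y n) powr q) \<le> B powr q"
    using x y False by (auto simp: lp_bound_on_def q_def)
  have "(\<Sum>n\<in>F. cmod ((x + y) n) powr q) \<le> (\<Sum>n\<in>F. (cmod (x n) + cmod (y n)) powr q)"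
    using q by (intro sum_mono powr_mono2) (auto simp: norm_triangle_ineq)
  also have "\<dots> \<le> (\<Sum>n\<in>F. (A + B) powr q * (A / (A + B) * (cmod (x n) powr q / A powr q)
      + B / (A + B) * (cmod (y n) powr q / B powr q)))"
    using q A B by (intro sum_mono powr_add_convex) auto
  also have "\<dots> = (A + B) powr q * (A / (A + B) * ((\<Sum>n\<in>F. cmod (x n) powr q) / A powr q)
      + B / (A + B) * ((\<Sum>n\<in>F. cmod (y n) powr q) / B powr q))"
    by (simp only: sum_distrib_left[symmetric] sum.distrib sum_divide_distrib)
  also have "\<dots> \<le> (A + B) powr q * (A / (A + B) * 1 + B / (A + B) * 1)"
    using x' y' A B by (intro mult_left_mono add_mono) auto
  also have "\<dots> = (A + B) powr q" using A B by (simp add: add_divide_distrib[symmetric])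
  finally show ?thesis using False by (simp add: lp_bound_on_def q_def)
qed

lemma lp_bound_on_limit:
  assumes p: "1 \<le> p" and x: "\<And>k :: nat. lp_bound_on p F C (x k)" and lim: "\<And>n. (\<lambda>k. x k n) \<longlonglongrightarrow> y n"
  shows "lp_bound_on p F C y"
proof (cases "p = \<infinity>")
  case True
  have "cmod (y n) \<le> C" if "n \<in> F" for n
    by (rule LIMSEQ_le_const2[OF tendsto_norm[OF lim]]) (use x that True in \<open>auto simp: lp_bound_on_def\<close>)
  then show ?thesis using True by (simp add: lp_bound_on_def)
next
  case False
  define q where "q = real_of_ereal p"
  have q: "q \<ge> 1" using real_of_ereal_ge_1[OF p False] by (simp add: q_def)
  have "(\<lambda>k. \<Sum>n\<in>F. cmod (x k n) powr q) \<longlonglongrightarrow> (\<Sum>n\<in>F. cmod (y n) powr q)"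
    using q by (intro tendsto_sum tendsto_powr' tendsto_norm lim tendsto_const) auto
  then have "(\<Sum>n\<in>F. cmod (y n) powr q) \<le> C powr q"
    by (rule LIMSEQ_le_const2) (use x False in \<open>auto simp: lp_bound_on_def q_def\<close>)
  then show ?thesis using False by (simp add: lp_bound_on_def q_def)
qed

section \<open>Solidity, translations and the Fatou property of the lattice norms\<close>

lemma lp_solid:
  assumes p: "1 \<le> p" and c: "c \<ge> 0" and x: "x \<in> lp_space p h"
    and le: "\<And>n. cmod (y n) \<le> c * cmod (x n)"
  shows "y \<in> lp_space p h \<and> lp_norm p h y \<le> c * lp_norm p h x"
proof -
  have N: "lp_norm p h x \<ge> 0" by (rule lp_norm_nonneg[OF x])
  have x': "\<forall>n. n \<notin> lattice h \<longrightarrow> x n = 0" "\<forall>F. finite F \<longrightarrow> F \<subseteq> lattice h \<longrightarrow> lp_bound_on p F (lp_norm p h x) x"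
    using lp_bound_iff[OF p N, of x h] x by auto
  have "y n = 0" if "n \<notin> lattice h" for n using le[of n] x'(1) that by simp
  moreover have "lp_bound_on p F (c * lp_norm p h x) y" if "finite F" "F \<subseteq> lattice h" for F
    by (rule lp_bound_on_solid[OF p N c]) (use x'(2) that le in auto)
  ultimately show ?thesis using lp_bound_iff[OF p mult_nonneg_nonneg[OF c N], of y h] by blast
qed

lemma lp_shift:
  fixes x :: "real ^ 'd \<Rightarrow> complex"
  assumes p: "1 \<le> p" and x: "x \<in> lp_space p h" and e: "e \<in> lattice h"
  shows "(\<lambda>n. x (n + e)) \<in> lp_space p h \<and> lp_norm p h (\<lambda>n. x (n + e)) \<le> lp_norm p h x"
proof -
  have N: "lp_norm p h x \<ge> 0" by (rule lp_norm_nonneg[OF x])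
  have x': "\<forall>n. n \<notin> lattice h \<longrightarrow> x n = 0" "\<forall>F. finite F \<longrightarrow> F \<subseteq> lattice h \<longrightarrow> lp_bound_on p F (lp_norm p h x) x"
    using lp_bound_iff[OF p N, of x h] x by auto
  have "x (n + e) = 0" if "n \<notin> lattice h" for n
    using lattice_diff[OF _ e, of "n + e"] that x'(1) by auto
  moreover have "lp_bound_on p F (lp_norm p h x) (\<lambda>n. x (n + e))" if F: "finite F" "F \<subseteq> lattice h" for F
  proof -
    let ?E = "(\<lambda>n. n + e) ` F"
    have "?E \<subseteq> lattice h" using F lattice_add[OF _ e] by auto
    then have "lp_bound_on p ?E (lp_norm p h x) x"
      by (rule x'(2)[rule_format, OF finite_imageI[OF F(1)]])
    moreover have "(\<Sum>n\<in>?E. cmod (x n) powr q) = (\<Sum>n\<in>F. cmod (x (n + e)) powr q)" for q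
      by (subst sum.reindex) (auto simp: inj_on_def)
    ultimately show ?thesis unfolding lp_bound_on_def by auto
  qed
  ultimately show ?thesis using lp_bound_iff[OF p N, of "\<lambda>n. x (n + e)" h] by blast
qed

lemma fatou_norm_lp:
  assumes p: "1 \<le> p"
  shows "fatou_norm (lp_space p h :: (real ^ 'd \<Rightarrow> complex) set) (lp_norm p h)"
proof
  let ?X = "lp_space p h :: (real ^ 'd \<Rightarrow> complex) set" and ?N = "lp_norm p h :: (real ^ 'd \<Rightarrow> complex) \<Rightarrow> real"
  have bound: "(\<forall>n. n \<notin> lattice h \<longrightarrow> x n = 0) \<and> (\<forall>F. finite F \<longrightarrow> F \<subseteq> lattice h \<longrightarrow> lp_bound_on p F C x)"
    if "x \<in> ?X" "?N x \<le> C" for x C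
    using lp_bound_iff[OF p, of C x h] that lp_norm_nonneg[of x p h] by auto
  have zero: "(\<forall>n. n \<notin> lattice h \<longrightarrow> (0 :: real ^ 'd \<Rightarrow> complex) n = 0) \<and>
      (\<forall>F. finite F \<longrightarrow> F \<subseteq> lattice h \<longrightarrow> lp_bound_on p F 0 (0 :: real ^ 'd \<Rightarrow> complex))"
    by (auto simp: lp_bound_on_def)
  show "0 \<in> ?X" using lp_bound_iff[OF p, of 0 "0 :: real ^ 'd \<Rightarrow> complex" h] zero by blast
  \<comment> \<open>The Minkowski argument divides by both bounds, so each norm is enlarged by
    \<open>d / 2\<close> to be positive; \<open>d\<close> is arbitrary, which removes it at the
    end.\<close>
  have add: "x + y \<in> ?X \<and> ?N (x + y) \<le> ?N x + ?N y + d" if xy: "x \<in> ?X" "y \<in> ?X" and d: "d > 0" for x y d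
  proof -
    define A B where "A = ?N x + d / 2" and "B = ?N y + d / 2"
    have AB: "A > 0" "B > 0" "A + B = ?N x + ?N y + d"
      using d lp_norm_nonneg[OF xy(1)] lp_norm_nonneg[OF xy(2)] by (auto simp: A_def B_def)
    have "?N x \<le> A" "?N y \<le> B" using d by (auto simp: A_def B_def)
    note bx = bound[OF xy(1) this(1)] and bd = bound[OF xy(2) this(2)]
    have "(x + y) n = 0" if "n \<notin> lattice h" for n using bx bd that by simp
    moreover have "lp_bound_on p F (A + B) (x + y)" if F: "finite F" "F \<subseteq> lattice h" for F
      by (rule lp_bound_on_add[OF p AB(1,2) bx[THEN conjunct2, rule_format, OF F] bd[THEN conjunct2, rule_format, OF F]])
    ultimately have "x + y \<in> ?X \<and> ?N (x + y) \<le> A + B"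
      using lp_bound_iff[OF p, of "A + B" "x + y" h] AB(1,2) by simp
    then show ?thesis unfolding AB(3) .
  qed
  show "x + y \<in> ?X" if "x \<in> ?X" "y \<in> ?X" for x y using add[OF that, of 1] by simp
  show "?N (x + y) \<le> ?N x + ?N y" if "x \<in> ?X" "y \<in> ?X" for x y
    by (rule field_le_epsilon) (use add[OF that] in blast)
  show "(\<lambda>n. c * x n) \<in> ?X" "?N (\<lambda>n. c * x n) \<le> cmod c * ?N x" if "x \<in> ?X" for x c
    using lp_solid[OF p norm_ge_zero[of c] that, of "\<lambda>n. c * x n"] by (auto simp: norm_mult)
  show "cmod (x n) \<le> ?N x" if x: "x \<in> ?X" for x n
  proof (cases "n \<in> lattice h")
    case False
    then have "x n = 0" using bound[OF x order_refl] by blast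
    then show ?thesis using lp_norm_nonneg[OF x] by simp
  next
    case True
    then have *: "lp_bound_on p {n} (?N x) x" using bound[OF x order_refl] by simp
    show ?thesis
    proof (cases "p = \<infinity>")
      case False
      have q: "real_of_ereal p \<ge> 1" by (rule real_of_ereal_ge_1[OF p False])
      then show ?thesis
        using * False powr_less_mono2[of "real_of_ereal p" "?N x" "cmod (x n)"] lp_norm_nonneg[OF x]
        unfolding lp_bound_on_def by fastforce
    qed (use * in \<open>simp add: lp_bound_on_def\<close>)
  qed
  show "y \<in> ?X \<and> ?N y \<le> C"
    if x: "\<And>k. xs k \<in> ?X" "\<And>k. ?N (xs k) \<le> C" and lim: "\<And>n. (\<lambda>k. xs k n) \<longlonglongrightarrow> y n"
    for xs :: "nat \<Rightarrow> real ^ 'd \<Rightarrow> complex" and C y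
  proof -
    have C: "C \<ge> 0" using lp_norm_nonneg[OF x(1)[of 0]] x(2)[of 0] by linarith
    have "y n = 0" if "n \<notin> lattice h" for n
    proof -
      have "xs k n = 0" for k using bound[OF x] that by blast
      then have "(\<lambda>k. 0) \<longlonglongrightarrow> y n" using lim[of n] by simp
      then show ?thesis using LIMSEQ_unique tendsto_const by blast
    qed
    moreover have "lp_bound_on p F C y" if "finite F" "F \<subseteq> lattice h" for F
      by (rule lp_bound_on_limit[OF p _ lim]) (use bound[OF x] that in blast)
    ultimately show ?thesis using lp_bound_iff[OF p C, of y h] by blast
  qed
qed

text \<open>For \<open>cmod w \<le> cmod z\<close> and truncated moduli \<open>a \<le> b\<close>,
  the difference equals \<open>b powr s * (z - w) + (b powr s - a powr s) * w\<close>. The first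
  term contributes \<open>1\<close> and the second \<open>s + 1\<close> to the constant
  \<open>s + 2\<close>.\<close>

lemma truncated_power_lipschitz:
  fixes z w :: complex and s R :: real
  assumes s: "s > 0" and R: "R \<ge> 0"
  shows "cmod (of_real (min (cmod z) R powr s) * z - of_real (min (cmod w) R powr s) * w)
    \<le> (s + 2) * R powr s * cmod (z - w)"
proof -
  have main: "cmod (of_real (min (cmod z) R powr s) * z - of_real (min (cmod w) R powr s) * w)
      \<le> (s + 2) * R powr s * cmod (z - w)" if le: "cmod w \<le> cmod z" for z w :: complex
  proof -
    define a b where "a = min (cmod w) R" and "b = min (cmod z) R"
    have ab: "0 \<le> a" "a \<le> b" "b \<le> R" using le R by (auto simp: a_def b_def)
    have mono: "a powr s \<le> b powr s" "b powr s \<le> R powr s" using ab s by (auto intro!: powr_mono2)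
    have part: "(b powr s - a powr s) * cmod w \<le> (s + 1) * R powr s * cmod (z - w)"
    proof (cases "cmod w \<le> R")
      \<comment> \<open>Above the level \<open>R\<close> both moduli are cut to \<open>R\<close>,
        and the difference of powers vanishes.\<close>
      case False
      then have "a = R" "b = R" using le by (auto simp: a_def b_def)
      then show ?thesis using s by simp
    next
      case True
      then have aw: "a = cmod w" by (simp add: a_def)
      have "b - a \<le> cmod z - cmod w" using aw by (simp add: b_def)
      also have "\<dots> \<le> cmod (z - w)" by (rule norm_triangle_ineq2)
      finally have d: "b - a \<le> cmod (z - w)" .
      \<comment> \<open>The factor \<open>a \<le> b\<close> raises the exponent to
        \<open>s + 1\<close>, for which the mean value theorem gives a bounded slope down to
        \<open>0\<close>, also when \<open>s < 1\<close>.\<close>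
      have "(b powr s - a powr s) * a \<le> b powr (s + 1) - a powr (s + 1)"
        using ab by (simp add: powr_add left_diff_distrib mult_left_mono)
      also have "\<dots> \<le> (s + 1) * R powr s * (b - a)"
      proof (cases "a = b")
        case False
        then have "a < b" using ab by simp
        obtain y where y: "a < y" "y < b"
          and "b powr (s + 1) - a powr (s + 1) = (\<lambda>d. (s + 1) * y powr s * d) (b - a)"
        proof (rule mvt[OF \<open>a < b\<close>])
          show "continuous_on {a..b} (\<lambda>y. y powr (s + 1))"
            using ab s by (intro continuous_on_powr' continuous_intros) auto
          show "((\<lambda>y. y powr (s + 1)) has_derivative (\<lambda>d. (s + 1) * y powr s * d)) (at y)"
            if "a < y" "y < b" for y
          proof -
            have "((\<lambda>y. y powr (s + 1)) has_real_derivative (s + 1) * y powr (s + 1 - 1)) (at y)"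
              using that ab by (intro has_real_derivative_powr) auto
            then show ?thesis by (simp add: has_field_derivative_def)
          qed
        qed
        then have y': "b powr (s + 1) - a powr (s + 1) = (b - a) * ((s + 1) * y powr s)"
          by (simp add: mult_ac)
        have "y powr s \<le> R powr s" using y ab s by (intro powr_mono2) auto
        then have "(b - a) * ((s + 1) * y powr s) \<le> (b - a) * ((s + 1) * R powr s)"
          using ab s by (intro mult_left_mono) auto
        then show ?thesis unfolding y' by (simp add: mult_ac)
      qed simp
      also have "\<dots> \<le> (s + 1) * R powr s * cmod (z - w)" using d s by (intro mult_left_mono) auto
      finally show ?thesis by (simp add: aw)
    qed
    have "of_real (b powr s) * z - of_real (a powr s) * w
        = of_real (b powr s) * (z - w) + of_real (b powr s - a powr s) * w"
      by (simp add: algebra_simps)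
    also have "cmod \<dots> \<le> b powr s * cmod (z - w) + (b powr s - a powr s) * cmod w"
      using mono by (intro order_trans[OF norm_triangle_ineq]) (simp add: norm_mult del: of_real_diff)
    also have "\<dots> \<le> R powr s * cmod (z - w) + (s + 1) * R powr s * cmod (z - w)"
      using mono part by (intro add_mono mult_right_mono) auto
    finally show ?thesis by (simp add: a_def b_def algebra_simps)
  qed
  show ?thesis
  proof (cases "cmod w \<le> cmod z")
    case False
    then show ?thesis using main[of z w] by (subst norm_minus_commute, subst (2) norm_minus_commute) simp
  qed (rule main)
qed

section \<open>The discrete nonlinear Schroedinger equation\<close>

lemma discrete_laplacian_diff:
  "discrete_laplacian h (x - y) n = discrete_laplacian h x n - discrete_laplacian h y n"
  unfolding discrete_laplacian_def sum_subtractf[symmetric]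
  by (rule sum.cong) (simp_all add: algebra_simps flip: diff_divide_distrib)

text \<open>In each direction two translates and twice \<open>x\<close> itself make up the
  \<open>4\<close>; summing over the directions gives the dimension.\<close>

lemma lp_discrete_laplacian:
  fixes x :: "real ^ 'd \<Rightarrow> complex"
  assumes p: "1 \<le> p" and h: "h > 0" and x: "x \<in> lp_space p h"
  shows "discrete_laplacian h x \<in> lp_space p h \<and>
    lp_norm p h (discrete_laplacian h x) \<le> real CARD('d) * (4 / h\<^sup>2) * lp_norm p h x"
proof -
  let ?X = "lp_space p h :: (real ^ 'd \<Rightarrow> complex) set" and ?N = "lp_norm p h :: (real ^ 'd \<Rightarrow> complex) \<Rightarrow> real"
  interpret fatou_norm ?X ?N by (rule fatou_norm_lp[OF p])
  define U D where "U j = (\<lambda>n. x (n + h *\<^sub>R axis j 1))" and "D j = (\<lambda>n. x (n - h *\<^sub>R axis j 1))" for j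
  define M where "M = (\<lambda>n. 2 * x n)"
  define T where "T j = (\<lambda>n. of_real (1 / h\<^sup>2) * (U j + D j - M) n)" for j
  have U: "U j \<in> ?X \<and> ?N (U j) \<le> ?N x" for j
    unfolding U_def by (rule lp_shift[OF p x step_in_lattice])
  have D: "D j \<in> ?X \<and> ?N (D j) \<le> ?N x" for j
    using lp_shift[OF p x uminus_in_lattice[OF step_in_lattice[of h j]]] by (simp add: D_def)
  have M: "M \<in> ?X \<and> ?N M \<le> 2 * ?N x"
    using scale_mem[OF x, of 2] N_scale[OF x, of 2] by (simp add: M_def)
  have T: "T j \<in> ?X \<and> ?N (T j) \<le> 4 / h\<^sup>2 * ?N x" for j
  proof -
    have mem: "U j + D j - M \<in> ?X" using U D M by (intro diff_mem add_mem) auto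
    have "?N (U j + D j - M) \<le> ?N (U j + D j) + ?N M" using U D M by (intro N_diff add_mem) auto
    moreover have "?N (U j + D j) \<le> ?N (U j) + ?N (D j)" using U D by (intro N_add) auto
    ultimately have "?N (U j + D j - M) \<le> 4 * ?N x" using U[of j] D[of j] M by linarith
    then have "1 / h\<^sup>2 * ?N (U j + D j - M) \<le> 1 / h\<^sup>2 * (4 * ?N x)" by (intro mult_left_mono) auto
    moreover have "?N (T j) \<le> 1 / h\<^sup>2 * ?N (U j + D j - M)"
      unfolding T_def using N_scale[OF mem, of "of_real (1 / h\<^sup>2)"] by (simp only: norm_of_real) simp
    moreover have "T j \<in> ?X" unfolding T_def by (rule scale_mem[OF mem])
    ultimately show ?thesis by simp
  qed
  have eq: "discrete_laplacian h x = (\<lambda>n. \<Sum>j\<in>UNIV. T j n)"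
    by (rule ext) (simp add: discrete_laplacian_def T_def U_def D_def M_def)
  have "(\<lambda>n. \<Sum>j\<in>UNIV. T j n) \<in> ?X \<and> ?N (\<lambda>n. \<Sum>j\<in>UNIV. T j n) \<le> (\<Sum>j\<in>UNIV. ?N (T j))"
    by (rule sum_mem_N_le) (use T in auto)
  moreover have "(\<Sum>j\<in>UNIV. ?N (T j)) \<le> real CARD('d) * (4 / h\<^sup>2 * ?N x)"
    by (rule sum_bounded_above) (use T in blast)
  ultimately show ?thesis unfolding eq by simp
qed

text \<open>The right-hand side after solving for the time derivative, the inverse of
  \<open>\<i>\<close> being \<open>- \<i>\<close>. With the nonlinearity \<open>g\<close> as a
  parameter, one formula covers the original field and its truncations.\<close>

definition dnls_field ::
    "real \<Rightarrow> real \<Rightarrow> (real ^ 'd \<Rightarrow> real) \<Rightarrow> (complex \<Rightarrow> complex) \<Rightarrow> (real ^ 'd \<Rightarrow> complex) \<Rightarrow> real ^ 'd \<Rightarrow> complex"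
  where "dnls_field h lam V g u n =
    - \<i> * (discrete_laplacian h u n - of_real (V n) * u n - of_real lam * g (u n))"

text \<open>Potential and nonlinearity act coordinatewise, so their pointwise bounds
  \<open>B\<close> and \<open>M\<close> carry over to the norm by \<open>lp_solid\<close>; only the
  Laplacian couples different lattice points.\<close>

lemma lipschitz_field_dnls:
  fixes V :: "real ^ 'd \<Rightarrow> real"
  assumes p: "1 \<le> p" and h: "h > 0"
    and V: "\<And>n. n \<in> lattice h \<Longrightarrow> \<bar>V n\<bar> \<le> B" and B: "B \<ge> 0"
    and g: "\<And>z w. cmod (g z - g w) \<le> M * cmod (z - w)" and g0: "g 0 = 0" and M: "M \<ge> 0"
  shows "lipschitz_field (lp_space p h) (lp_norm p h) (dnls_field h lam V g)
    (real CARD('d) * (4 / h\<^sup>2) + B + \<bar>lam\<bar> * M)"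
proof -
  let ?X = "lp_space p h :: (real ^ 'd \<Rightarrow> complex) set" and ?N = "lp_norm p h :: (real ^ 'd \<Rightarrow> complex) \<Rightarrow> real"
  interpret fatou_norm ?X ?N by (rule fatou_norm_lp[OF p])
  let ?L = "real CARD('d) * (4 / h\<^sup>2) + B + \<bar>lam\<bar> * M"
  have combine: "(\<lambda>n. - \<i> * (a - b - c) n) \<in> ?X \<and> ?N (\<lambda>n. - \<i> * (a - b - c) n) \<le> ?N a + ?N b + ?N c"
    if "a \<in> ?X" "b \<in> ?X" "c \<in> ?X" for a b c
  proof -
    have mem: "a - b - c \<in> ?X" by (intro diff_mem that)
    have "?N (\<lambda>n. - \<i> * (a - b - c) n) \<le> ?N (a - b - c)" using N_scale[OF mem, of "- \<i>"] by simp
    moreover have "?N (a - b - c) \<le> ?N (a - b) + ?N c" by (intro N_diff diff_mem that)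
    moreover have "?N (a - b) \<le> ?N a + ?N b" by (intro N_diff that)
    ultimately show ?thesis using scale_mem[OF mem, of "- \<i>"] by linarith
  qed
  have potential: "(\<lambda>n. of_real (V n) * x n) \<in> ?X \<and> ?N (\<lambda>n. of_real (V n) * x n) \<le> B * ?N x"
    if x: "x \<in> ?X" for x
  proof (rule lp_solid[OF p B x])
    fix n
    show "cmod (of_real (V n) * x n) \<le> B * cmod (x n)"
    proof (cases "n \<in> lattice h")
      case True
      then show ?thesis using V[OF True] by (simp add: norm_mult mult_right_mono)
    next
      case False
      then have "x n = 0" using x by (simp add: lp_space_def)
      then show ?thesis by simp
    qed
  qed
  have nonlinear: "(\<lambda>n. of_real lam * (g (x n) - g (y n))) \<in> ?X \<and>
      ?N (\<lambda>n. of_real lam * (g (x n) - g (y n))) \<le> \<bar>lam\<bar> * M * ?N (x - y)"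
    if "x \<in> ?X" "y \<in> ?X" for x y
  proof (rule lp_solid[OF p _ diff_mem[OF that]])
    show "0 \<le> \<bar>lam\<bar> * M" using M by simp
    show "cmod (of_real lam * (g (x n) - g (y n))) \<le> \<bar>lam\<bar> * M * cmod ((x - y) n)" for n
      using mult_left_mono[OF g[of "x n" "y n"], of "\<bar>lam\<bar>"] by (simp add: norm_mult mult_ac)
  qed
  show ?thesis
  proof
    fix x y assume x: "x \<in> ?X" and y: "y \<in> ?X"
    note d = diff_mem[OF x y]
    have eq: "dnls_field h lam V g x - dnls_field h lam V g y =
        (\<lambda>n. - \<i> * (discrete_laplacian h (x - y) - (\<lambda>n. of_real (V n) * (x - y) n)
          - (\<lambda>n. of_real lam * (g (x n) - g (y n)))) n)"
      by (rule ext) (simp add: dnls_field_def discrete_laplacian_diff algebra_simps)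
    have "?N (dnls_field h lam V g x - dnls_field h lam V g y) \<le> ?N (discrete_laplacian h (x - y))
        + ?N (\<lambda>n. of_real (V n) * (x - y) n) + ?N (\<lambda>n. of_real lam * (g (x n) - g (y n)))"
      unfolding eq
      by (intro combine[THEN conjunct2] potential[THEN conjunct1] nonlinear[THEN conjunct1]
          lp_discrete_laplacian[THEN conjunct1] p h d x y)
    also have "\<dots> \<le> real CARD('d) * (4 / h\<^sup>2) * ?N (x - y) + B * ?N (x - y) + \<bar>lam\<bar> * M * ?N (x - y)"
      by (intro add_mono potential[THEN conjunct2] nonlinear[THEN conjunct2]
          lp_discrete_laplacian[THEN conjunct2] p h d x y)
    also have "\<dots> = ?L * ?N (x - y)" by (simp only: distrib_right)
    finally show "?N (dnls_field h lam V g x - dnls_field h lam V g y) \<le> ?L * ?N (x - y)" .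
  next
    fix x assume x: "x \<in> ?X"
    \<comment> \<open>Subtracting \<open>g 0 = 0\<close> makes the difference estimate
      \<open>nonlinear\<close>, taken at \<open>y = 0\<close>, provide membership as well.\<close>
    have eq: "dnls_field h lam V g x = (\<lambda>n. - \<i> * (discrete_laplacian h x - (\<lambda>n. of_real (V n) * x n)
        - (\<lambda>n. of_real lam * (g (x n) - g ((0 :: real ^ 'd \<Rightarrow> complex) n)))) n)"
      by (rule ext) (simp add: dnls_field_def g0)
    show "dnls_field h lam V g x \<in> ?X"
      unfolding eq
      by (intro combine[THEN conjunct1] potential[THEN conjunct1] nonlinear[THEN conjunct1]
          lp_discrete_laplacian[THEN conjunct1] p h x zero_mem)
  next
    have "real CARD('d) * (4 / h\<^sup>2) > 0" using h by (intro mult_pos_pos) auto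
    moreover have "0 \<le> \<bar>lam\<bar> * M" using M by simp
    ultimately show "?L > 0" using B by linarith
  qed
qed

text \<open>Off the lattice the added conditions hold automatically: neighbours of such a point are
  again off the lattice, so both \<open>u\<close> and the field vanish there.\<close>

lemma solves_dnls_iff:
  fixes V :: "real ^ 'd \<Rightarrow> real"
  assumes u: "\<And>t n. t \<in> I \<Longrightarrow> n \<notin> lattice h \<Longrightarrow> u t n = 0"
  shows "solves_dnls h \<sigma> lam V I u \<longleftrightarrow> (\<forall>t\<in>I. \<forall>n. ((\<lambda>s. u s n) has_vector_derivative
    dnls_field h lam V (\<lambda>z. of_real (cmod z powr (2 * \<sigma>)) * z) (u t) n) (at t within I))"
proof -
  let ?G = "dnls_field h lam V (\<lambda>z. of_real (cmod z powr (2 * \<sigma>)) * z)"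
  have G: "\<i> * u' - discrete_laplacian h v n + of_real (V n) * v n
      + of_real lam * of_real (cmod (v n) powr (2 * \<sigma>)) * v n = 0 \<longleftrightarrow> u' = ?G v n" for u' v n
  proof -
    define w where "w = discrete_laplacian h v n - of_real (V n) * v n
      - of_real lam * of_real (cmod (v n) powr (2 * \<sigma>)) * v n"
    have "\<i> * u' - w = 0 \<longleftrightarrow> u' = - \<i> * w"
    proof
      assume "\<i> * u' - w = 0"
      then have "w = \<i> * u'" by simp
      then show "u' = - \<i> * w" by (simp flip: mult.assoc)
    qed (simp flip: mult.assoc)
    moreover have "\<i> * u' - w = \<i> * u' - discrete_laplacian h v n + of_real (V n) * v n
        + of_real lam * of_real (cmod (v n) powr (2 * \<sigma>)) * v n" by (simp add: w_def)
    moreover have "?G v n = - \<i> * w" by (simp add: dnls_field_def w_def mult.assoc)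
    ultimately show ?thesis by simp
  qed
  have off: "((\<lambda>s. u s n) has_vector_derivative ?G (u t) n) (at t within I)"
    if t: "t \<in> I" and n: "n \<notin> lattice h" for t n
  proof -
    have "n + h *\<^sub>R axis j 1 \<notin> lattice h" "n - h *\<^sub>R axis j 1 \<notin> lattice h" for j
      using lattice_diff[OF _ step_in_lattice[of h j], of "n + h *\<^sub>R axis j 1"]
        lattice_add[OF _ step_in_lattice[of h j], of "n - h *\<^sub>R axis j 1"] n by auto
    then have "?G (u t) n = 0"
      using u[OF t] n by (simp add: dnls_field_def discrete_laplacian_def)
    moreover have "((\<lambda>s. u s n) has_vector_derivative 0) (at t within I)"
      by (rule has_vector_derivative_transform[OF t _ has_vector_derivative_const[of 0]]) (use u n in simp)
    ultimately show ?thesis by simp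
  qed
  show ?thesis unfolding solves_dnls_def G using off by auto
qed

theorem theorem1p2:
  fixes h \<sigma> lam :: real and p :: ereal and V :: "real ^ 'd \<Rightarrow> real"
  assumes "h > 0" and "\<sigma> > 0" and "1 \<le> p" and "lam \<in> {1, -1}"
    and "bounded (V ` lattice h)"
  shows "locally_well_posed (lp_space p h) (lp_norm p h) (solves_dnls h \<sigma> lam V)"
proof -
  let ?X = "lp_space p h :: (real ^ 'd \<Rightarrow> complex) set" and ?N = "lp_norm p h :: (real ^ 'd \<Rightarrow> complex) \<Rightarrow> real"
  define g where "g z = of_real (cmod z powr (2 * \<sigma>)) * z" for z :: complex
  obtain B where B: "B > 0" "\<And>n. n \<in> lattice h \<Longrightarrow> \<bar>V n\<bar> \<le> B"
    using assms(5) by (auto simp: bounded_pos)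
  interpret fatou_norm ?X ?N by (rule fatou_norm_lp[OF assms(3)])
  interpret truncatable_equation ?X ?N "dnls_field h lam V g" "solves_dnls h \<sigma> lam V"
  proof
    fix R :: real
    \<comment> \<open>\<open>R\<close> ranges over all reals, while the Lipschitz estimate asks for
      a nonnegative level; for negative \<open>R\<close> the agreement with \<open>g\<close> is
      vacuous.\<close>
    define S where "S = max R 0"
    define k where "k z = of_real (min (cmod z) S powr (2 * \<sigma>)) * z" for z :: complex
    have "lipschitz_field ?X ?N (dnls_field h lam V k)
        (real CARD('d) * (4 / h\<^sup>2) + B + \<bar>lam\<bar> * ((2 * \<sigma> + 2) * S powr (2 * \<sigma>)))"
    proof (rule lipschitz_field_dnls[OF assms(3,1)])
      show "cmod (k z - k w) \<le> (2 * \<sigma> + 2) * S powr (2 * \<sigma>) * cmod (z - w)" for z w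
        unfolding k_def using assms(2) by (intro truncated_power_lipschitz) (auto simp: S_def)
    qed (use B assms(2) in \<open>auto simp: k_def\<close>)
    moreover have "dnls_field h lam V k x = dnls_field h lam V g x" if x: "x \<in> ?X" "?N x \<le> R" for x
    proof -
      have "min (cmod (x n)) S = cmod (x n)" for n
        using N_point[OF x(1), of n] x(2) by (simp add: S_def)
      then show ?thesis by (simp add: fun_eq_iff dnls_field_def k_def g_def)
    qed
    ultimately show "\<exists>K L. lipschitz_field ?X ?N K L \<and> (\<forall>x\<in>?X. ?N x \<le> R \<longrightarrow> K x = dnls_field h lam V g x)"
      by (intro exI conjI ballI impI)
  next
    fix I and u :: "real \<Rightarrow> real ^ 'd \<Rightarrow> complex" assume "\<And>t. t \<in> I \<Longrightarrow> u t \<in> ?X"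
    then have "u t n = 0" if "t \<in> I" "n \<notin> lattice h" for t n
      using that by (simp add: lp_space_def)
    then show "solves_dnls h \<sigma> lam V I u \<longleftrightarrow>
        (\<forall>t\<in>I. \<forall>n. ((\<lambda>s. u s n) has_vector_derivative dnls_field h lam V g (u t) n) (at t within I))"
      unfolding g_def by (rule solves_dnls_iff)
  qed
  show ?thesis by (rule locally_well_posed_eqn)
qed

end
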